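(* Let $(K,\nu)$ be a henselian valued field, $\bar K$ an algebraic closure of $K$ and $\bar\nu$ the unique extension of $\nu$ to $\bar K$. Let $\mu$ be a valuation of $K[x]$ extending $\nu$, let $\mathcal A=(\mu_i)_{i\in I}$ be the admitted family of valuations associated with $\mu$, and for $i\in I$ let $\mathcal B_i=\mathcal B(\mu_i)$ be the finite family of closed balls of $\bar K$ associated with $\mu_i$. Then the family $(\mathcal B_i)_{i\in I}$ is decreasing, i.e. for all $i<j$ in $I$: every ball $B_i^{(r)}$ of $\mathcal B_i$ contains $s$ balls $B_j^{(l)}$ belonging to $\mathcal B_j$, where $s$ is a strictly positive integer independent of the chosen ball $B_i^{(r)}$, and every ball $B_j^{(l)}$ of $\mathcal B_j$ is contained in some ball $B_i^{(r)}$ of $\mathcal B_i$.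
   Context: Valuations are written additively. $\tilde\Gamma$ is a fixed totally ordered abelian group containing the value groups of $\nu$, $\bar\nu$ and of all valuations considered. Valuations of $K[x]$ extend $\nu$, valuations of $\bar K[x]$ extend $\bar\nu$. For a valued field $(F,v)$, $a\in F$, $\delta\in\tilde\Gamma$: $\omega_{(a,\delta)}(\sum_j c_j(x-a)^j)=\min_j(v(c_j)+j\delta)$ on $F[x]$. Key polynomials (MacLane). Let $\mu$ be a valuation of $K[x]$. $f,g$ are $\mu$-equivalent if $\mu(f-g)>\mu(f)=\mu(g)$; $g$ $\mu$-divides $f$ if $f$ is $\mu$-equivalent to $gh$ for some $h$. A monic $\phi$ is a key polynomial for $\mu$ if it is $\mu$-irreducible (it does not $\mu$-divide $1$, and if it $\mu$-divides $fg$ it $\mu$-divides $f$ or $g$) and $\mu$-minimal (if $\phi$ $\mu$-divides $f\ne0$ then $\deg f\ge\deg\phi$). If $\gamma>\mu(\phi)$, the augmented valuation $\mu'=[\mu;\mu'(\phi)=\gamma]$ is $\mu'(\sum_j g_j\phi^j)=\min_j(\mu(g_j)+j\gamma)$, $\deg g_j<\deg\phi$. Also $\omega_{(a,\gamma)}=[\nu;\mu(x-a)=\gamma]$ is regarded as an augmented valuation. Continuous admissible family: $\mathcal C=(\mu_\alpha)_{\alpha\in A}$, $A$ totally ordered without greatest element, with $\mu_\alpha=[\mu;\mu_\alpha(\phi_\alpha)=\gamma_\alpha]$ for a fixed base valuation $\mu$ of $K[x]$ (possibly the first member), all $\phi_\alpha$ of the same degree $d$, $(\gamma_\alpha)$ strictly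 increasing, $\mu_\beta=[\mu_\alpha;\mu_\beta(\phi_\beta)=\gamma_\beta]$ for $\alpha<\beta$, and such that every element of $\tilde\Phi(\mathcal C)=\{f:\mu_\alpha(f)<\mu_\beta(f)\ \forall\alpha<\beta\}$ has degree $>d$. If $\tilde\Phi(\mathcal C)\ne\emptyset$, a limit key polynomial is a monic $\phi\in\tilde\Phi(\mathcal C)$ of minimal degree; for $\gamma>\mu_\alpha(\phi)$ for all $\alpha$, the limit augmented valuation $\mu'=[(\mu_\alpha)_\alpha;\mu'(\phi)=\gamma]$ is $\mu'(\sum g_j\phi^j)=\min_j(\sup_\alpha\mu_\alpha(g_j)+j\gamma)$, $\deg g_j<\deg\phi$. A valuation $\mu$ is well-specified if it is an augmented valuation (including $\omega_{(a,\gamma)}$) or a limit augmented valuation; the (limit) key polynomial $\phi$ appearing in such a presentation is said to define $\mu$. Admissible family $\mathcal A=(\mu_i)_{i\in I}$: a concatenation of simple families $\mathcal S^{(j)}=(\mathcal D^{(j)};\mathcal C^{(j)})$, $j\in J$, $J=\{1,\dots,N\}$ or $J=\mathbb N^*$, where $\mathcal D^{(j)}=(\mu_l)_{l\in L}$, $L=\{1,\dots,n\}$ or $\mathbb N^*$, is nonempty with $\mu_l=[\mu_{l-1};\mu_l(\phi_l)=\gamma_l]$ and $\deg\phi_l>\deg\phi_{l-1}$ for $l\ge2$; $\mathcal C^{(j)}$ is empty or, with $\mathcal D^{(j)}$ finite, is a continuous admissible family with base the last valuation $\mu_n$ of $\mathcal D^{(j)}$ and of degree $\deg\phi_n$; if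 $j$ is not the last index, $\mathcal D^{(j)}$ is finite, $\mathcal C^{(j)}$ is nonempty and the first valuation of $\mathcal S^{(j+1)}$ is a limit augmented valuation for $\mathcal C^{(j)}$; the first valuation of $\mathcal S^{(1)}$ is some $\omega_{(a,\gamma)}$. $I$ carries the concatenation order. If $\mathcal S^{(j)}$ has a one-element discrete part $\{\mu_1\}$ and nonempty continuous part, $\mu_1$ may be regarded as belonging to the continuous part. $\mathcal A$ is admitted if for every $f\in K[x]$ the family $(\mu_i(f))_{i\in I}$ has a greatest element; it is associated with $\mu$ if $\mu(f)=\max_i\mu_i(f)$ for all $f$. Every valuation $\mu$ of $K[x]$ has an associated admitted family (unique up to a natural equivalence), and each $\mu_i$ is well-specified. Balls: for $b\in\bar K$, $\delta\in\tilde\Gamma$, $B(b,\delta)=\{c\in\bar K:\bar\nu(b-c)\ge\delta\}$. If $\mu$ is a well-specified valuation of $K[x]$ defined by $\phi$ and $a$ is a root of $\phi$ in $\bar K$, there are $\delta\in\tilde\Gamma$ and finitely many $\sigma_1,\dots,\sigma_k\in\mathrm{Gal}(\bar K/K)$ such that the distinct extensions of $\mu$ to $\bar K[x]$ are the $\omega_{(\sigma_l(a),\delta)}$, $1\le l\le k$; $\mathcal B(\mu)$ is the family of the pairwise disjoint closed balls $B^{(l)}=B(\sigma_l(a),\delta)$. *)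

theory Defs
  imports "HOL-Algebra.Algebraic_Closure_Type" "HOL-Library.Extended"
begin

text \<open>
  Throughout, the type \<^typ>\<open>'g\<close> plays the role of the fixed totally ordered abelian group
  in which all valuations take their values, \<^typ>\<open>'k\<close> is the base field and
  \<^typ>\<open>'k alg_closure\<close> (with embedding \<^const>\<open>to_ac\<close>) its algebraic closure.
  Values live in \<^typ>\<open>'g extended\<close>; \<^const>\<open>Pinf\<close> is the value of zero and of zero only, and
  \<^const>\<open>Minf\<close> never occurs.
\<close>

definition valuation :: "('r::idom \<Rightarrow> 'g::linordered_ab_group_add extended) \<Rightarrow> bool" where
  "valuation v \<longleftrightarrow>
     (\<forall>x. v x \<noteq> Minf) \<and>
     (\<forall>x. v x = Pinf \<longleftrightarrow> x = 0) \<and>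
     (\<forall>x y. v (x * y) = v x + v y) \<and>
     (\<forall>x y. min (v x) (v y) \<le> v (x + y))"

definition extends_to_closure ::
  "('k::field \<Rightarrow> 'g::linordered_ab_group_add extended) \<Rightarrow> ('k alg_closure \<Rightarrow> 'g extended) \<Rightarrow> bool" where
  "extends_to_closure \<nu> w \<longleftrightarrow> valuation w \<and> (\<forall>c. w (to_ac c) = \<nu> c)"

text \<open>
  Uniqueness is literal equality rather than equivalence of valuations: two equivalent extensions
  with values in the same ordered group agree, because the value group of an extension is torsion
  over the value group of \<open>\<nu>\<close>. Existence in \<^typ>\<open>'g\<close> expresses that \<^typ>\<open>'g\<close> contains the
  value group of the extension.
\<close>

definition henselian :: "('k::field \<Rightarrow> 'g::linordered_ab_group_add extended) \<Rightarrow> bool" where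
  "henselian \<nu> \<longleftrightarrow> valuation \<nu> \<and> (\<exists>!w. extends_to_closure \<nu> w)"

definition poly_valuation ::
  "('f::field \<Rightarrow> 'g::linordered_ab_group_add extended) \<Rightarrow> ('f poly \<Rightarrow> 'g extended) \<Rightarrow> bool" where
  "poly_valuation v \<mu> \<longleftrightarrow> valuation \<mu> \<and> (\<forall>c. \<mu> [:c:] = v c)"

definition nat_scale :: "nat \<Rightarrow> 'g::linordered_ab_group_add \<Rightarrow> 'g" where
  "nat_scale n \<delta> = (\<Sum>i<n. \<delta>)"

text \<open>The coefficients of \<open>f\<close> in powers of \<open>x - a\<close> are the coefficients of \<open>f(x + a)\<close>.\<close>

definition omega ::
  "('f::field \<Rightarrow> 'g::linordered_ab_group_add extended) \<Rightarrow> 'f \<Rightarrow> 'g \<Rightarrow> 'f poly \<Rightarrow> 'g extended" where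
  "omega v a \<delta> f =
     (MIN j\<in>{..degree f}. v (coeff (pcompose f [:a, 1:]) j) + Fin (nat_scale j \<delta>))"

lemma omega_expansion:
  fixes f :: "'f::field poly"
  shows "f = (\<Sum>j\<le>degree f. smult (coeff (pcompose f [:a, 1:]) j) ([:-a, 1:] ^ j))"
proof -
  let ?g = "pcompose f [:a, 1:]"
  have "f = pcompose ?g [:-a, 1:]"
    by (simp add: pcompose_assoc[symmetric] pcompose_pCons)
  also have "\<dots> = (\<Sum>j\<le>degree ?g. [:coeff ?g j:] * [:-a, 1:] ^ j)"
    by (simp only: pcompose_altdef poly_altdef) (simp add: degree_map_poly coeff_map_poly)
  also have "\<dots> = (\<Sum>j\<le>degree f. smult (coeff ?g j) ([:-a, 1:] ^ j))"
    by (simp add: degree_pcompose)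
  finally show ?thesis .
qed

definition val_equiv ::
  "('k::field poly \<Rightarrow> 'g::linordered_ab_group_add extended) \<Rightarrow> 'k poly \<Rightarrow> 'k poly \<Rightarrow> bool" where
  "val_equiv \<mu> f g \<longleftrightarrow> \<mu> (f - g) > \<mu> f \<and> \<mu> f = \<mu> g"

definition val_dvd ::
  "('k::field poly \<Rightarrow> 'g::linordered_ab_group_add extended) \<Rightarrow> 'k poly \<Rightarrow> 'k poly \<Rightarrow> bool" where
  "val_dvd \<mu> g f \<longleftrightarrow> (\<exists>h. val_equiv \<mu> f (g * h))"

definition val_irreducible ::
  "('k::field poly \<Rightarrow> 'g::linordered_ab_group_add extended) \<Rightarrow> 'k poly \<Rightarrow> bool" where
  "val_irreducible \<mu> \<phi> \<longleftrightarrow>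
     \<not> val_dvd \<mu> \<phi> 1 \<and> (\<forall>f g. val_dvd \<mu> \<phi> (f * g) \<longrightarrow> val_dvd \<mu> \<phi> f \<or> val_dvd \<mu> \<phi> g)"

definition val_minimal ::
  "('k::field poly \<Rightarrow> 'g::linordered_ab_group_add extended) \<Rightarrow> 'k poly \<Rightarrow> bool" where
  "val_minimal \<mu> \<phi> \<longleftrightarrow> (\<forall>f. f \<noteq> 0 \<longrightarrow> val_dvd \<mu> \<phi> f \<longrightarrow> degree \<phi> \<le> degree f)"

definition key_polynomial ::
  "('k::field poly \<Rightarrow> 'g::linordered_ab_group_add extended) \<Rightarrow> 'k poly \<Rightarrow> bool" where
  "key_polynomial \<mu> \<phi> \<longleftrightarrow> lead_coeff \<phi> = 1 \<and> val_irreducible \<mu> \<phi> \<and> val_minimal \<mu> \<phi>"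

definition expansion_coeff :: "'k::field poly \<Rightarrow> 'k poly \<Rightarrow> nat \<Rightarrow> 'k poly" where
  "expansion_coeff \<phi> f j = (f div \<phi> ^ j) mod \<phi>"

lemma degree_expansion_coeff:
  "degree \<phi> > 0 \<Longrightarrow> degree (expansion_coeff \<phi> f j) < degree \<phi>"
  unfolding expansion_coeff_def
  by (cases "f div \<phi> ^ j mod \<phi> = 0") (auto intro: degree_mod_less')

lemma expansion:
  fixes f :: "'k::field poly"
  assumes "degree \<phi> > 0"
  shows "f = (\<Sum>j\<le>degree f. expansion_coeff \<phi> f j * \<phi> ^ j)"
proof -
  have *: "f = (\<Sum>j<n. expansion_coeff \<phi> f j * \<phi> ^ j) + (f div \<phi> ^ n) * \<phi> ^ n" for n
  proof (induction n)
    case (Suc n)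
    have "f div \<phi> ^ n = (f div \<phi> ^ Suc n) * \<phi> + expansion_coeff \<phi> f n"
      unfolding expansion_coeff_def power_Suc2 poly_div_mult_right
      by (rule div_mult_mod_eq[symmetric])
    then have "(f div \<phi> ^ n) * \<phi> ^ n =
        expansion_coeff \<phi> f n * \<phi> ^ n + (f div \<phi> ^ Suc n) * \<phi> ^ Suc n"
      by (simp add: algebra_simps)
    with Suc show ?case by (simp add: add.assoc)
  qed simp
  have "\<phi> \<noteq> 0" using assms by auto
  then have "degree (\<phi> ^ Suc (degree f)) = Suc (degree f) * degree \<phi>"
    by (simp add: degree_power_eq del: power_Suc)
  also have "\<dots> \<ge> Suc (degree f) * 1"
    using assms by (intro mult_le_mono2) simp
  finally have "degree f < degree (\<phi> ^ Suc (degree f))"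
    by simp
  then have "f div \<phi> ^ Suc (degree f) = 0"
    by (rule div_poly_less)
  with *[of "Suc (degree f)"] show ?thesis by (simp add: lessThan_Suc_atMost)
qed

definition augment ::
  "('k::field poly \<Rightarrow> 'g::linordered_ab_group_add extended) \<Rightarrow> 'k poly \<Rightarrow> 'g \<Rightarrow> 'k poly \<Rightarrow> 'g extended" where
  "augment \<mu> \<phi> \<gamma> f = (MIN j\<in>{..degree f}. \<mu> (expansion_coeff \<phi> f j) + Fin (nat_scale j \<gamma>))"

text \<open>\<open>\<mu>' = [\<mu>; \<mu>'(\<phi>) = \<gamma>]\<close>\<close>

definition augmented ::
  "('k::field \<Rightarrow> 'g::linordered_ab_group_add extended) \<Rightarrow> ('k poly \<Rightarrow> 'g extended) \<Rightarrow>
   'k poly \<Rightarrow> 'g \<Rightarrow> ('k poly \<Rightarrow> 'g extended) \<Rightarrow> bool" where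
  "augmented \<nu> \<mu> \<phi> \<gamma> \<mu>' \<longleftrightarrow>
     poly_valuation \<nu> \<mu> \<and> key_polynomial \<mu> \<phi> \<and> \<mu> \<phi> < Fin \<gamma> \<and> \<mu>' = augment \<mu> \<phi> \<gamma>"

definition limit_polys ::
  "'a::linorder set \<Rightarrow> ('a \<Rightarrow> 'k::field poly \<Rightarrow> 'g::linordered_ab_group_add extended) \<Rightarrow> 'k poly set" where
  "limit_polys A \<mu>s = {f. \<forall>\<alpha>\<in>A. \<forall>\<beta>\<in>A. \<alpha> < \<beta> \<longrightarrow> \<mu>s \<alpha> f < \<mu>s \<beta> f}"

text \<open>
  The base valuation is not listed as a member of the family. If it were listed as first member,
  neither the elements of \<^const>\<open>limit_polys\<close> nor the limit augmented valuations would change: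
  for \<open>\<alpha> < \<beta>\<close>, a polynomial with the same value under the base valuation and \<open>\<mu>s \<alpha>\<close> also
  has the same value under \<open>\<mu>s \<beta>\<close>.
\<close>

definition continuous_family ::
  "('k::field \<Rightarrow> 'g::linordered_ab_group_add extended) \<Rightarrow> ('k poly \<Rightarrow> 'g extended) \<Rightarrow> nat \<Rightarrow>
   'a::linorder set \<Rightarrow> ('a \<Rightarrow> 'k poly) \<Rightarrow> ('a \<Rightarrow> 'g) \<Rightarrow> ('a \<Rightarrow> 'k poly \<Rightarrow> 'g extended) \<Rightarrow> bool" where
  "continuous_family \<nu> \<mu>\<^sub>0 d A \<phi>s \<gamma>s \<mu>s \<longleftrightarrow>
     A \<noteq> {} \<and> (\<forall>\<alpha>\<in>A. \<exists>\<beta>\<in>A. \<alpha> < \<beta>) \<and>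
     (\<forall>\<alpha>\<in>A. degree (\<phi>s \<alpha>) = d \<and> augmented \<nu> \<mu>\<^sub>0 (\<phi>s \<alpha>) (\<gamma>s \<alpha>) (\<mu>s \<alpha>)) \<and>
     strict_mono_on A \<gamma>s \<and>
     (\<forall>\<alpha>\<in>A. \<forall>\<beta>\<in>A. \<alpha> < \<beta> \<longrightarrow> augmented \<nu> (\<mu>s \<alpha>) (\<phi>s \<beta>) (\<gamma>s \<beta>) (\<mu>s \<beta>)) \<and>
     (\<forall>f\<in>limit_polys A \<mu>s. d < degree f)"

definition limit_key_polynomial ::
  "'a::linorder set \<Rightarrow> ('a \<Rightarrow> 'k::field poly \<Rightarrow> 'g::linordered_ab_group_add extended) \<Rightarrow> 'k poly \<Rightarrow> bool" where
  "limit_key_polynomial A \<mu>s \<phi> \<longleftrightarrow>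
     lead_coeff \<phi> = 1 \<and> \<phi> \<in> limit_polys A \<mu>s \<and> (\<forall>f\<in>limit_polys A \<mu>s. degree \<phi> \<le> degree f)"

text \<open>
  The inner \<open>LEAST\<close> is the supremum of the \<open>\<mu>s \<alpha> g\<close>; it is only applied to \<open>g\<close> of degree less
  than that of a limit key polynomial, for which these values are eventually constant.
\<close>

definition limit_augment ::
  "'a set \<Rightarrow> ('a \<Rightarrow> 'k::field poly \<Rightarrow> 'g::linordered_ab_group_add extended) \<Rightarrow>
   'k poly \<Rightarrow> 'g \<Rightarrow> 'k poly \<Rightarrow> 'g extended" where
  "limit_augment A \<mu>s \<phi> \<gamma> f =
     (MIN j\<in>{..degree f}.
        (LEAST u. \<forall>\<alpha>\<in>A. \<mu>s \<alpha> (expansion_coeff \<phi> f j) \<le> u) + Fin (nat_scale j \<gamma>))"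

text \<open>\<open>\<mu>' = [(\<mu>s \<alpha>)\<^sub>\<alpha>; \<mu>'(\<phi>) = \<gamma>]\<close> for a family already known to be continuous\<close>

definition limit_augmented ::
  "'a::linorder set \<Rightarrow> ('a \<Rightarrow> 'k::field poly \<Rightarrow> 'g::linordered_ab_group_add extended) \<Rightarrow>
   'k poly \<Rightarrow> 'g \<Rightarrow> ('k poly \<Rightarrow> 'g extended) \<Rightarrow> bool" where
  "limit_augmented A \<mu>s \<phi> \<gamma> \<mu>' \<longleftrightarrow>
     limit_key_polynomial A \<mu>s \<phi> \<and> (\<forall>\<alpha>\<in>A. \<mu>s \<alpha> \<phi> < Fin \<gamma>) \<and> \<mu>' = limit_augment A \<mu>s \<phi> \<gamma>"

text \<open>
  In the limit case the continuous family is indexed by a subset of \<^typ>\<open>'g\<close>. Since the values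
  \<open>\<gamma>s\<close> are strictly increasing, this covers every index set, see \<open>defined_by_limitI\<close>.
\<close>

definition defined_by ::
  "('k::field \<Rightarrow> 'g::linordered_ab_group_add extended) \<Rightarrow> ('k poly \<Rightarrow> 'g extended) \<Rightarrow> 'k poly \<Rightarrow> bool" where
  "defined_by \<nu> \<mu> \<phi> \<longleftrightarrow>
     (\<exists>a \<gamma>. \<phi> = [:-a, 1:] \<and> \<mu> = omega \<nu> a \<gamma>) \<or>
     (\<exists>\<mu>\<^sub>0 \<gamma>. augmented \<nu> \<mu>\<^sub>0 \<phi> \<gamma> \<mu>) \<or>
     (\<exists>\<mu>\<^sub>0 d (A :: 'g set) \<phi>s \<gamma>s \<mu>s \<gamma>.
        continuous_family \<nu> \<mu>\<^sub>0 d A \<phi>s \<gamma>s \<mu>s \<and> limit_augmented A \<mu>s \<phi> \<gamma> \<mu>)"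

lemma defined_by_limitI:
  fixes A :: "'a::linorder set" and \<gamma>s :: "'a \<Rightarrow> 'g::linordered_ab_group_add"
  assumes cf: "continuous_family \<nu> \<mu>\<^sub>0 d A \<phi>s \<gamma>s \<mu>s" and la: "limit_augmented A \<mu>s \<phi> \<gamma> \<mu>"
  shows "defined_by \<nu> \<mu> \<phi>"
proof -
  have mono: "strict_mono_on A \<gamma>s" using cf by (simp add: continuous_family_def)
  then have inj: "inj_on \<gamma>s A" by (rule strict_mono_on_imp_inj_on)
  have less: "\<gamma>s x < \<gamma>s y \<longleftrightarrow> x < y" if "x \<in> A" "y \<in> A" for x y
    using mono that by (rule strict_mono_on_less)
  let ?B = "\<gamma>s ` A" and ?i = "inv_into A \<gamma>s"
  have inv: "?i (\<gamma>s x) = x" if "x \<in> A" for x using inj that by simp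
  have lp: "limit_polys ?B (\<mu>s \<circ> ?i) = limit_polys A \<mu>s"
    by (auto simp: limit_polys_def inv less)
  have "continuous_family \<nu> \<mu>\<^sub>0 d ?B (\<phi>s \<circ> ?i) (\<gamma>s \<circ> ?i) (\<mu>s \<circ> ?i)"
    using cf unfolding continuous_family_def lp
    by (auto simp: inv less intro!: strict_mono_onI)
  moreover have "limit_augmented ?B (\<mu>s \<circ> ?i) \<phi> \<gamma> \<mu>"
    using la unfolding limit_augmented_def limit_key_polynomial_def limit_augment_def lp
    by (simp add: inv)
  ultimately show ?thesis unfolding defined_by_def by blast
qed

definition galois_group :: "('k::field alg_closure \<Rightarrow> 'k alg_closure) set" where
  "galois_group = {\<sigma>. bij \<sigma> \<and> (\<forall>x y. \<sigma> (x + y) = \<sigma> x + \<sigma> y) \<and> (\<forall>x y. \<sigma> (x * y) = \<sigma> x * \<sigma> y) \<and>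
     (\<forall>c. \<sigma> (to_ac c) = to_ac c)}"

definition closed_ball ::
  "('f::field \<Rightarrow> 'g::linordered_ab_group_add extended) \<Rightarrow> 'f \<Rightarrow> 'g \<Rightarrow> 'f set" where
  "closed_ball v b \<delta> = {c. Fin \<delta> \<le> v (b - c)}"

definition extensions ::
  "('k::field alg_closure \<Rightarrow> 'g::linordered_ab_group_add extended) \<Rightarrow> ('k poly \<Rightarrow> 'g extended) \<Rightarrow>
   ('k alg_closure poly \<Rightarrow> 'g extended) set" where
  "extensions \<nu>' \<mu> = {\<omega>. poly_valuation \<nu>' \<omega> \<and> (\<forall>f. \<omega> (map_poly to_ac f) = \<mu> f)}"

text \<open>
  \<open>\<B>\<close> is the family of balls of the well-specified valuation \<open>\<mu>\<close>. Distinct extensions have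
  distinct balls, so the family is a set. That \<open>S\<close> is nonempty expresses that \<^typ>\<open>'g\<close>
  contains the value groups of the extensions of \<open>\<mu>\<close>.
\<close>

definition is_ball_family ::
  "('k::field \<Rightarrow> 'g::linordered_ab_group_add extended) \<Rightarrow> ('k alg_closure \<Rightarrow> 'g extended) \<Rightarrow>
   ('k poly \<Rightarrow> 'g extended) \<Rightarrow> 'k alg_closure set set \<Rightarrow> bool" where
  "is_ball_family \<nu> \<nu>' \<mu> \<B> \<longleftrightarrow>
     (\<exists>\<phi> a \<delta> S. defined_by \<nu> \<mu> \<phi> \<and> poly (map_poly to_ac \<phi>) a = 0 \<and>
        S \<subseteq> galois_group \<and> finite S \<and> S \<noteq> {} \<and>
        extensions \<nu>' \<mu> = (\<lambda>\<sigma>. omega \<nu>' (\<sigma> a) \<delta>) ` S \<and>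
        \<B> = (\<lambda>\<sigma>. closed_ball \<nu>' (\<sigma> a) \<delta>) ` S)"

text \<open>
  Indices of a concatenation of simple families: \<open>Disc j l\<close> is the \<open>l\<close>-th index of the discrete
  part, and \<open>Cont j \<alpha>\<close> the index \<open>\<alpha>\<close> of the continuous part, of the \<open>j\<close>-th simple family.
\<close>

datatype 'a fam_index = Disc nat nat | Cont nat 'a

fun fam_less :: "'a::linorder fam_index \<Rightarrow> 'a fam_index \<Rightarrow> bool" where
  "fam_less (Disc j l) (Disc j' l') \<longleftrightarrow> j < j' \<or> j = j' \<and> l < l'"
| "fam_less (Disc j l) (Cont j' \<beta>) \<longleftrightarrow> j \<le> j'"
| "fam_less (Cont j \<alpha>) (Disc j' l') \<longleftrightarrow> j < j'"
| "fam_less (Cont j \<alpha>) (Cont j' \<beta>) \<longleftrightarrow> j < j' \<or> j = j' \<and> \<alpha> < \<beta>"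

definition fam_indices :: "nat set \<Rightarrow> (nat \<Rightarrow> nat set) \<Rightarrow> (nat \<Rightarrow> 'a set) \<Rightarrow> 'a fam_index set" where
  "fam_indices J L A = {Disc j l | j l. j \<in> J \<and> l \<in> L j} \<union> {Cont j \<alpha> | j \<alpha>. j \<in> J \<and> \<alpha> \<in> A j}"

definition initial_segment :: "nat set \<Rightarrow> bool" where
  "initial_segment L \<longleftrightarrow> (\<exists>n\<ge>1. L = {1..n}) \<or> L = {1..}"

definition simple_family ::
  "('k::field \<Rightarrow> 'g::linordered_ab_group_add extended) \<Rightarrow>
   nat set \<Rightarrow> (nat \<Rightarrow> 'k poly) \<Rightarrow> (nat \<Rightarrow> 'g) \<Rightarrow> (nat \<Rightarrow> 'k poly \<Rightarrow> 'g extended) \<Rightarrow>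
   'a::linorder set \<Rightarrow> ('a \<Rightarrow> 'k poly) \<Rightarrow> ('a \<Rightarrow> 'g) \<Rightarrow> ('a \<Rightarrow> 'k poly \<Rightarrow> 'g extended) \<Rightarrow> bool" where
  "simple_family \<nu> L \<phi>d \<gamma>d \<mu>d A \<phi>c \<gamma>c \<mu>c \<longleftrightarrow>
     initial_segment L \<and>
     (\<forall>l\<in>L. 2 \<le> l \<longrightarrow>
        augmented \<nu> (\<mu>d (l - 1)) (\<phi>d l) (\<gamma>d l) (\<mu>d l) \<and> degree (\<phi>d (l - 1)) < degree (\<phi>d l)) \<and>
     (A = {} \<or>
      finite L \<and> continuous_family \<nu> (\<mu>d (Max L)) (degree (\<phi>d (Max L))) A \<phi>c \<gamma>c \<mu>c)"

text \<open>
  Whether the single valuation of a one-element discrete part is counted as belonging to the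
  continuous part changes neither the family nor its order, so it needs no separate clause.
\<close>

definition admissible_family ::
  "('k::field \<Rightarrow> 'g::linordered_ab_group_add extended) \<Rightarrow> nat set \<Rightarrow> (nat \<Rightarrow> nat set) \<Rightarrow>
   (nat \<Rightarrow> 'a::linorder set) \<Rightarrow> ('a fam_index \<Rightarrow> 'k poly \<Rightarrow> 'g extended) \<Rightarrow> bool" where
  "admissible_family \<nu> J L A \<mu>s \<longleftrightarrow>
     (\<exists>\<phi> \<gamma>.
        initial_segment J \<and>
        (\<forall>j\<in>J. simple_family \<nu>
           (L j) (\<lambda>l. \<phi> (Disc j l)) (\<lambda>l. \<gamma> (Disc j l)) (\<lambda>l. \<mu>s (Disc j l))
           (A j) (\<lambda>\<alpha>. \<phi> (Cont j \<alpha>)) (\<lambda>\<alpha>. \<gamma> (Cont j \<alpha>)) (\<lambda>\<alpha>. \<mu>s (Cont j \<alpha>))) \<and>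
        (\<exists>a. \<phi> (Disc 1 1) = [:-a, 1:] \<and> \<mu>s (Disc 1 1) = omega \<nu> a (\<gamma> (Disc 1 1))) \<and>
        (\<forall>j. j \<in> J \<and> Suc j \<in> J \<longrightarrow>
           finite (L j) \<and> A j \<noteq> {} \<and>
           limit_augmented (A j) (\<lambda>\<alpha>. \<mu>s (Cont j \<alpha>))
             (\<phi> (Disc (Suc j) 1)) (\<gamma> (Disc (Suc j) 1)) (\<mu>s (Disc (Suc j) 1))))"

definition admitted ::
  "'i set \<Rightarrow> ('i \<Rightarrow> 'k::field poly \<Rightarrow> 'g::linordered_ab_group_add extended) \<Rightarrow> bool" where
  "admitted I \<mu>s \<longleftrightarrow> (\<forall>f. \<exists>i\<in>I. \<forall>k\<in>I. \<mu>s k f \<le> \<mu>s i f)"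

definition associated_family ::
  "'i set \<Rightarrow> ('i \<Rightarrow> 'k::field poly \<Rightarrow> 'g::linordered_ab_group_add extended) \<Rightarrow>
   ('k poly \<Rightarrow> 'g extended) \<Rightarrow> bool" where
  "associated_family I \<mu>s \<mu> \<longleftrightarrow> (\<forall>f. (\<exists>i\<in>I. \<mu> f = \<mu>s i f) \<and> (\<forall>i\<in>I. \<mu>s i f \<le> \<mu> f))"

end

theory Submission
  imports Defs
begin

text \<open>
  Each ball family is a single orbit of balls under the Galois group. Given this, the theorem rests on
  two facts.

  \<^item> The valuations of an admissible family increase (\<open>admissible_family_mono\<close>). For an ordinary
    augmentation this holds because a remainder modulo a key polynomial never has smaller value than
    the dividend. For a limit augmentation the same is true far enough in the continuous family, since
    the values of the coefficients become stationary (\<open>continuous_family_stable\<close>).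

  \<^item> If \<open>\<mu> \<le> \<mu>'\<close>, every ball of \<open>\<mu>'\<close> lies in a ball of \<open>\<mu>\<close>
    (\<open>closed_ball_subset_conjugate\<close>). Let \<open>a\<close> and \<open>b\<close> be centres. The minimal
    polynomial of \<open>a\<close> over the base field splits over the closure, and the value of a linear
    factor \<open>x - c\<close> under \<open>omega\<close> is the minimum of the radius and the distance of the
    centre to \<open>c\<close>. A comparison factor by factor for \<open>b\<close> and a nearest conjugate of
    \<open>a\<close> shows that the ball around \<open>b\<close> lies in the one around that conjugate.

  The number of smaller balls in a larger one is constant because the Galois group acts transitively
  on the larger balls, and positive because some smaller ball lies in some larger one. The action
  preserves distances as the ground field is henselian, and it is transitive on conjugates since
  isomorphisms between subfields of the closure extend to it (\<open>galois_conjugate\<close>).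
\<close>

section \<open>The absolute Galois group\<close>

lemma map_poly_hom_add:
  fixes h :: "'r::comm_ring_1 \<Rightarrow> 's::comm_ring_1"
  assumes "h 0 = 0" "\<And>x y. h (x + y) = h x + h y"
  shows "map_poly h (p + q) = map_poly h p + map_poly h q"
  by (rule poly_eqI) (simp add: coeff_map_poly assms)

lemma map_poly_hom_mult:
  fixes h :: "'r::comm_ring_1 \<Rightarrow> 's::comm_ring_1"
  assumes h0: "h 0 = 0" and add: "\<And>x y. h (x + y) = h x + h y"
    and mult: "\<And>x y. h (x * y) = h x * h y"
  shows "map_poly h (p * q) = map_poly h p * map_poly h q"
proof (rule poly_eqI)
  fix n
  have sum: "h (\<Sum>i\<in>I. g i) = (\<Sum>i\<in>I. h (g i))" if "finite I" for I :: "nat set" and g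
    using that by (induction I) (auto simp: h0 add)
  show "coeff (map_poly h (p * q)) n = coeff (map_poly h p * map_poly h q) n"
    by (simp add: coeff_map_poly h0 coeff_mult sum mult)
qed

lemma map_poly_hom_poly:
  fixes h :: "'r::comm_ring_1 \<Rightarrow> 's::comm_ring_1"
  assumes "h 0 = 0" "\<And>x y. h (x + y) = h x + h y" "\<And>x y. h (x * y) = h x * h y"
  shows "poly (map_poly h p) (h x) = h (poly p x)"
  by (induction p) (auto simp: map_poly_pCons assms)

lemma map_poly_hom_pcompose:
  fixes h :: "'r::comm_ring_1 \<Rightarrow> 's::comm_ring_1"
  assumes h: "h 0 = 0" "\<And>x y. h (x + y) = h x + h y" "\<And>x y. h (x * y) = h x * h y"
  shows "map_poly h (pcompose p q) = pcompose (map_poly h p) (map_poly h q)"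
proof (induction p)
  case (pCons a p)
  have "map_poly h (pcompose (pCons a p) q) = map_poly h ([:a:] + q * pcompose p q)"
    by (simp only: pcompose_pCons)
  also have "\<dots> = map_poly h [:a:] + map_poly h q * map_poly h (pcompose p q)"
    by (simp only: map_poly_hom_add[OF h(1,2)] map_poly_hom_mult[OF h])
  also have "\<dots> = pcompose (map_poly h (pCons a p)) (map_poly h q)"
    by (simp add: map_poly_pCons h pcompose_pCons pCons.IH)
  finally show ?case .
qed simp

abbreviation to_acp :: "'k::field poly \<Rightarrow> 'k alg_closure poly" where
  "to_acp \<equiv> map_poly to_ac"

lemma to_acp_mult: "to_acp (p * q) = to_acp p * to_acp q"
  by (rule map_poly_hom_mult) auto

lemma to_acp_add: "to_acp (p + q) = to_acp p + to_acp q"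
  by (rule map_poly_hom_add) auto

lemma to_acp_eq_0_iff [simp]: "to_acp p = 0 \<longleftrightarrow> p = 0"
  by (rule map_poly_eq_0_iff) auto

text \<open>
  A homomorphism over the base field from a subring of the closure into the closure, given by its
  graph: the last clause says that the graph is a function, and such a function is injective
  because every subring containing the base field is a field.
\<close>

definition partial_embedding :: "('k::field alg_closure \<times> 'k alg_closure) set \<Rightarrow> bool" where
  "partial_embedding \<Gamma> \<longleftrightarrow>
     (\<forall>c. (to_ac c, to_ac c) \<in> \<Gamma>) \<and>
     (\<forall>x y x' y'. (x, y) \<in> \<Gamma> \<longrightarrow> (x', y') \<in> \<Gamma> \<longrightarrow> (x + x', y + y') \<in> \<Gamma>) \<and>
     (\<forall>x y x' y'. (x, y) \<in> \<Gamma> \<longrightarrow> (x', y') \<in> \<Gamma> \<longrightarrow> (x * x', y * y') \<in> \<Gamma>) \<and>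
     (\<forall>y. (0, y) \<in> \<Gamma> \<longrightarrow> y = 0)"

lemma partial_embeddingD:
  assumes "partial_embedding \<Gamma>"
  shows "(to_ac c, to_ac c) \<in> \<Gamma>"
    and "(x, y) \<in> \<Gamma> \<Longrightarrow> (x', y') \<in> \<Gamma> \<Longrightarrow> (x + x', y + y') \<in> \<Gamma>"
    and "(x, y) \<in> \<Gamma> \<Longrightarrow> (x', y') \<in> \<Gamma> \<Longrightarrow> (x * x', y * y') \<in> \<Gamma>"
    and "(0, y) \<in> \<Gamma> \<Longrightarrow> y = 0"
  using assms unfolding partial_embedding_def by blast+

lemma partial_embedding_more:
  assumes \<Gamma>: "partial_embedding \<Gamma>"
  shows "(0, 0) \<in> \<Gamma>" "(1, 1) \<in> \<Gamma>"
    and "(x, y) \<in> \<Gamma> \<Longrightarrow> (- x, - y) \<in> \<Gamma>"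
    and "(x, y) \<in> \<Gamma> \<Longrightarrow> (x', y') \<in> \<Gamma> \<Longrightarrow> (x - x', y - y') \<in> \<Gamma>"
proof -
  show 0: "(0, 0) \<in> \<Gamma>" "(1, 1) \<in> \<Gamma>"
    using partial_embeddingD(1)[OF \<Gamma>, of 0] partial_embeddingD(1)[OF \<Gamma>, of 1] by simp_all
  show uminus: "(- x, - y) \<in> \<Gamma>" if "(x, y) \<in> \<Gamma>" for x y
    using partial_embeddingD(3)[OF \<Gamma> partial_embeddingD(1)[OF \<Gamma>, of "-1"] that] by simp
  show "(x - x', y - y') \<in> \<Gamma>" if "(x, y) \<in> \<Gamma>" "(x', y') \<in> \<Gamma>"
    using partial_embeddingD(2)[OF \<Gamma> that(1) uminus[OF that(2)]] by simp
qed

lemma partial_embedding_unique: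
  assumes "partial_embedding \<Gamma>" "(x, y) \<in> \<Gamma>" "(x, y') \<in> \<Gamma>"
  shows "y = y'"
  using partial_embedding_more(4)[OF assms] partial_embeddingD(4)[OF assms(1), of "y - y'"] by simp

lemma partial_embedding_poly:
  assumes \<Gamma>: "partial_embedding \<Gamma>" and xy: "(x, y) \<in> \<Gamma>"
  shows "(poly (to_acp p) x, poly (to_acp p) y) \<in> \<Gamma>"
proof (induction p)
  case 0
  then show ?case using partial_embedding_more(1)[OF \<Gamma>] by simp
next
  case (pCons a p)
  then show ?case
    using partial_embeddingD(2)[OF \<Gamma> partial_embeddingD(1)[OF \<Gamma>, of a]
        partial_embeddingD(3)[OF \<Gamma> xy pCons.IH]]
    by (simp add: map_poly_pCons)
qed

text \<open>
  As \<open>x\<close> is algebraic and nonzero, it is a root of a polynomial over the base field with nonzero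
  constant term, which expresses \<open>inverse x\<close> as a polynomial in \<open>x\<close>. Thus the domain of a
  partial embedding is a field.
\<close>

lemma partial_embedding_inverse:
  assumes \<Gamma>: "partial_embedding \<Gamma>" and xy: "(x, y) \<in> \<Gamma>" and x: "x \<noteq> 0"
  shows "(inverse x, inverse y) \<in> \<Gamma>"
proof -
  have "\<exists>c q. c \<noteq> 0 \<and> to_ac c + x * poly (to_acp q) x = 0"
  proof -
    have "\<exists>c q. c \<noteq> 0 \<and> to_ac c + x * poly (to_acp q) x = 0"
      if "p \<noteq> 0" "poly (to_acp p) x = 0" for p
      using that
    proof (induction p)
      case (pCons a p)
      then show ?case
        using x by (cases "a = 0") (auto simp: map_poly_pCons)
    qed simp
    then show ?thesis by (metis alg_closure_algebraic)
  qed
  then obtain c q where c: "c \<noteq> 0" and eq: "to_ac c + x * poly (to_acp q) x = 0"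
    by blast
  define z where "z = to_ac (- inverse c) * poly (to_acp q) y"
  have ix: "inverse x = to_ac (- inverse c) * poly (to_acp q) x"
  proof (rule inverse_unique)
    have "x * poly (to_acp q) x = - to_ac c"
      using eq by (simp add: eq_neg_iff_add_eq_0 add.commute)
    then show "x * (to_ac (- inverse c) * poly (to_acp q) x) = 1"
      using c by (simp only: mult.left_commute[of x]) simp
  qed
  have z: "(inverse x, z) \<in> \<Gamma>"
    unfolding ix z_def
    by (intro partial_embeddingD(3)[OF \<Gamma>] partial_embeddingD(1)[OF \<Gamma>]
        partial_embedding_poly[OF \<Gamma>] xy)
  have "(1, y * z) \<in> \<Gamma>"
    using partial_embeddingD(3)[OF \<Gamma> xy z] x by simp
  then have "y * z = 1"
    using partial_embedding_unique[OF \<Gamma> _ partial_embedding_more(2)[OF \<Gamma>]] by blast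
  then have "inverse y = z" by (rule inverse_unique)
  with z show ?thesis by simp
qed

lemma partial_embedding_eq_0_iff:
  assumes \<Gamma>: "partial_embedding \<Gamma>" and xy: "(x, y) \<in> \<Gamma>"
  shows "x = 0 \<longleftrightarrow> y = 0"
proof
  assume "x = 0"
  then show "y = 0" using partial_embeddingD(4)[OF \<Gamma>] xy by blast
next
  assume y: "y = 0"
  show "x = 0"
  proof (rule ccontr)
    assume x: "x \<noteq> 0"
    have "(1, 0) \<in> \<Gamma>"
      using partial_embeddingD(3)[OF \<Gamma> xy partial_embedding_inverse[OF \<Gamma> xy x]] x y by simp
    then have "0 = (1 :: 'a alg_closure)"
      using partial_embedding_unique[OF \<Gamma> _ partial_embedding_more(2)[OF \<Gamma>]] by blast
    then show False by simp
  qed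
qed

text \<open>
  Adjoining \<open>c\<close>: the coefficients of a minimal polynomial \<open>p0\<close> of \<open>c\<close> over the domain of
  \<open>\<Gamma>\<close> are transported to a polynomial \<open>q0\<close>, and \<open>c\<close> is sent to a root \<open>d\<close> of \<open>q0\<close>.
\<close>

lemma partial_embedding_extend:
  fixes c :: "'k::field alg_closure"
  assumes \<Gamma>: "partial_embedding \<Gamma>"
  shows "\<exists>\<Gamma>' d. partial_embedding \<Gamma>' \<and> \<Gamma> \<subseteq> \<Gamma>' \<and> (c, d) \<in> \<Gamma>'"
proof -
  define P where "P p q \<longleftrightarrow> (\<forall>i. (coeff p i, coeff q i) \<in> \<Gamma>)" for p q
  note D = partial_embeddingD[OF \<Gamma>] partial_embedding_more[OF \<Gamma>]
  have P_add: "P (p + p') (q + q')" if "P p q" "P p' q'" for p q p' q'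
    using that D(2) by (simp add: P_def)
  have P_diff: "P (p - p') (q - q')" if "P p q" "P p' q'" for p q p' q'
    using that D(8) by (simp add: P_def)
  have P_sum: "(\<Sum>i\<in>I. f i, \<Sum>i\<in>I. g i) \<in> \<Gamma>" if "finite I" "\<And>i. (f i, g i) \<in> \<Gamma>"
    for I :: "nat set" and f g
    using that by (induction I) (auto intro: D)
  have P_mult: "P (p * p') (q * q')" if "P p q" "P p' q'" for p q p' q'
    using that unfolding P_def coeff_mult by (auto intro!: P_sum D(3))
  have P_const: "P [:x:] [:y:]" if "(x, y) \<in> \<Gamma>" for x y
    using that D(5) by (auto simp: P_def coeff_pCons split: nat.split)
  have P_monom: "P (monom x n) (monom y n)" if "(x, y) \<in> \<Gamma>" for x y n
    using that D(5) by (auto simp: P_def)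
  have P_0: "coeff p i = 0 \<longleftrightarrow> coeff q i = 0" if "P p q" for p q i
    using that partial_embedding_eq_0_iff[OF \<Gamma>] by (auto simp: P_def)
  have P_acp: "P (to_acp p) (to_acp p)" for p
    by (auto simp: P_def coeff_map_poly D(1))
  define Q where "Q p \<longleftrightarrow> p \<noteq> 0 \<and> poly p c = 0 \<and> (\<exists>q. P p q)" for p
  have "\<exists>p. Q p"
    using alg_closure_algebraic[of c] P_acp unfolding Q_def by (metis to_acp_eq_0_iff)
  then obtain p0 where p0: "Q p0" and least: "\<And>p. Q p \<Longrightarrow> degree p0 \<le> degree p"
    using ex_has_least_nat[of Q _ degree] by blast
  obtain q0 where q0: "P p0 q0" using p0 by (auto simp: Q_def)
  have "degree p0 > 0"
    using p0 by (auto simp: Q_def elim!: degree_eq_zeroE intro!: Nat.gr0I)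
  moreover have "coeff q0 (degree p0) \<noteq> 0"
    using P_0[OF q0, of "degree p0"] p0 by (auto simp: Q_def)
  then have "degree p0 \<le> degree q0" by (rule le_degree)
  ultimately have "degree q0 > 0" by simp
  then obtain d where d: "poly q0 d = 0"
    using alg_closed_imp_poly_has_root by blast
  \<comment> \<open>Division by \<open>p0\<close>, carried out simultaneously on \<open>p\<close> and its transport \<open>q\<close>, shows that
    \<open>p(c) \<mapsto> q(d)\<close> is well defined; \<open>n\<close> bounds the degree and also covers \<open>p = 0\<close>.\<close>
  have vanish: "poly q d = 0" if "P p q" "poly p c = 0" "\<forall>i\<ge>n. coeff p i = 0" for n p q
    using that
  proof (induction n arbitrary: p q)
    case 0
    then have "p = 0" by (auto intro: poly_eqI)
    with P_0[OF 0(1)] have "q = 0" by (auto intro!: poly_eqI)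
    then show ?case by simp
  next
    case (Suc n)
    show ?case
    proof (cases "coeff p n = 0")
      case True
      then have "\<forall>i\<ge>n. coeff p i = 0" using Suc.prems(3) by (metis Suc_leI le_neq_implies_less)
      then show ?thesis using Suc by blast
    next
      case False
      then have "Q p" using Suc.prems by (auto simp: Q_def)
      moreover have "degree p \<le> n"
        using Suc.prems(3) by (intro degree_le) auto
      ultimately have dn: "degree p0 \<le> n" using least by fastforce
      define m where "m = degree p0"
      define u v where "u = coeff p n * inverse (coeff p0 m)" and "v = coeff q n * inverse (coeff q0 m)"
      have p0m: "coeff p0 m \<noteq> 0" using p0 by (simp add: m_def Q_def)
      have "(u, v) \<in> \<Gamma>"
        unfolding u_def v_def using Suc.prems(1) q0 p0m
        by (intro D(3) partial_embedding_inverse[OF \<Gamma>]) (auto simp: P_def)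
      then have P': "P (p - monom u (n - m) * p0) (q - monom v (n - m) * q0)"
        by (intro P_diff P_mult P_monom Suc.prems(1) q0)
      have zero: "\<forall>i\<ge>n. coeff (p - monom u (n - m) * p0) i = 0"
      proof (intro allI impI)
        fix i assume i: "n \<le> i"
        show "coeff (p - monom u (n - m) * p0) i = 0"
        proof (cases "i = n")
          case True
          then show ?thesis using dn p0m by (simp add: coeff_monom_mult m_def u_def)
        next
          case False
          with i have "coeff p i = 0" using Suc.prems(3) by simp
          moreover have "coeff p0 (i - (n - m)) = 0"
            using False i dn by (intro coeff_eq_0) (simp add: m_def)
          ultimately show ?thesis by (simp add: coeff_monom_mult)
        qed
      qed
      have "poly (q - monom v (n - m) * q0) d = 0"
        using p0 Suc.prems(2) by (intro Suc.IH[OF P' _ zero]) (simp add: Q_def)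
      then show ?thesis by (simp add: d)
    qed
  qed
  define \<Gamma>' where "\<Gamma>' = {(poly p c, poly q d) | p q. P p q}"
  have \<Gamma>'I: "(poly p c, poly q d) \<in> \<Gamma>'" if "P p q" for p q
    using that unfolding \<Gamma>'_def by blast
  have "partial_embedding \<Gamma>'"
    unfolding partial_embedding_def
  proof (intro conjI allI impI)
    fix a show "(to_ac a, to_ac a) \<in> \<Gamma>'"
      using \<Gamma>'I[OF P_const[OF D(1)[of a]]] by simp
  next
    fix x y x' y' assume "(x, y) \<in> \<Gamma>'" "(x', y') \<in> \<Gamma>'"
    then obtain p q p' q' where pq: "P p q" "P p' q'"
      and eq: "x = poly p c" "y = poly q d" "x' = poly p' c" "y' = poly q' d"
      by (auto simp: \<Gamma>'_def)
    show "(x + x', y + y') \<in> \<Gamma>'"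
      using \<Gamma>'I[OF P_add[OF pq]] by (simp add: eq)
    show "(x * x', y * y') \<in> \<Gamma>'"
      using \<Gamma>'I[OF P_mult[OF pq]] by (simp add: eq)
  next
    fix y assume "(0, y) \<in> \<Gamma>'"
    then obtain p q where pq: "P p q" "poly p c = 0" "y = poly q d"
      by (auto simp: \<Gamma>'_def)
    have "\<forall>i\<ge>Suc (degree p). coeff p i = 0" by (simp add: coeff_eq_0)
    with vanish[OF pq(1,2)] pq(3) show "y = 0" by blast
  qed
  moreover have "\<Gamma> \<subseteq> \<Gamma>'"
    using \<Gamma>'I[OF P_const] by auto
  moreover have "(c, d) \<in> \<Gamma>'"
    using \<Gamma>'I[OF P_monom[OF D(6), of 1]] by (simp add: poly_monom)
  ultimately show ?thesis by blast
qed

lemma partial_embedding_Union: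
  assumes chain: "subset.chain (Collect partial_embedding) C" and ne: "C \<noteq> {}"
  shows "partial_embedding (\<Union>C)"
proof -
  have mem: "partial_embedding Y" if "Y \<in> C" for Y
    using chain that by (auto simp: subset.chain_def)
  have both: "\<exists>Y\<in>C. p \<in> Y \<and> q \<in> Y" if "p \<in> \<Union>C" "q \<in> \<Union>C" for p q
    using that chain unfolding subset.chain_def by blast
  show ?thesis
    unfolding partial_embedding_def
  proof (intro conjI allI impI)
    fix a show "(to_ac a, to_ac a) \<in> \<Union>C"
      using ne mem partial_embeddingD(1) by blast
  next
    fix x y x' y' assume "(x, y) \<in> \<Union>C" "(x', y') \<in> \<Union>C"
    then obtain Y where Y: "Y \<in> C" "(x, y) \<in> Y" "(x', y') \<in> Y" using both by blast
    then show "(x + x', y + y') \<in> \<Union>C" "(x * x', y * y') \<in> \<Union>C"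
      using partial_embeddingD(2,3)[OF mem[OF Y(1)] Y(2,3)] by blast+
  next
    fix y assume "(0, y) \<in> \<Union>C"
    then show "y = 0" using mem partial_embeddingD(4) by blast
  qed
qed

lemma galois_hom:
  assumes "\<sigma> \<in> galois_group"
  shows "\<sigma> 0 = 0" "\<sigma> 1 = 1" "\<sigma> (x + y) = \<sigma> x + \<sigma> y" "\<sigma> (x * y) = \<sigma> x * \<sigma> y"
    "\<sigma> (x - y) = \<sigma> x - \<sigma> y" "\<sigma> (to_ac c) = to_ac c" "bij \<sigma>" "\<sigma> x = 0 \<longleftrightarrow> x = 0"
proof -
  have add: "\<sigma> (x + y) = \<sigma> x + \<sigma> y" for x y using assms by (auto simp: galois_group_def)
  show "\<sigma> (x + y) = \<sigma> x + \<sigma> y" "\<sigma> (x * y) = \<sigma> x * \<sigma> y" and bij: "bij \<sigma>"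
    using assms by (auto simp: galois_group_def)
  show to_ac: "\<sigma> (to_ac c) = to_ac c" for c using assms by (auto simp: galois_group_def)
  show zero: "\<sigma> 0 = 0" and "\<sigma> 1 = 1" using to_ac[of 0] to_ac[of 1] by simp_all
  show "\<sigma> x = 0 \<longleftrightarrow> x = 0" using zero bij by (metis bij_is_inj injD)
  show "\<sigma> (x - y) = \<sigma> x - \<sigma> y" using add[of "x - y" y] by (simp add: algebra_simps)
qed

lemma to_acp_hom_invariant:
  assumes "\<sigma> \<in> galois_group"
  shows "map_poly \<sigma> (to_acp p) = to_acp p"
  by (intro poly_eqI) (simp add: coeff_map_poly galois_hom[OF assms])

lemma galois_group_comp:
  "\<sigma> \<in> galois_group \<Longrightarrow> \<tau> \<in> galois_group \<Longrightarrow> \<sigma> \<circ> \<tau> \<in> galois_group"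
  by (auto simp: galois_group_def intro: bij_comp)

lemma galois_group_id: "id \<in> galois_group"
  by (auto simp: galois_group_def)

lemma galois_group_inv:
  assumes "\<sigma> \<in> galois_group"
  shows "inv_into UNIV \<sigma> \<in> galois_group"
proof -
  note hom = galois_hom[OF assms]
  have s: "\<sigma> (inv_into UNIV \<sigma> x) = x" for x using hom(7) by (simp add: bij_is_surj surj_f_inv_f)
  have i: "inv_into UNIV \<sigma> y = x" if "y = \<sigma> x" for x y
    using that hom(7) by (simp add: bij_is_inj)
  show ?thesis
    unfolding galois_group_def
  proof (intro CollectI conjI allI)
    show "bij (inv_into UNIV \<sigma>)" using hom(7) by (rule bij_imp_bij_inv)
    show "inv_into UNIV \<sigma> (x + y) = inv_into UNIV \<sigma> x + inv_into UNIV \<sigma> y" "inv_into UNIV \<sigma> (x * y) = inv_into UNIV \<sigma> x * inv_into UNIV \<sigma> y" for x y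
      by (rule i, simp add: hom s)+
    show "inv_into UNIV \<sigma> (to_ac c) = to_ac c" for c by (rule i) (simp add: hom)
  qed
qed

text \<open>
  The map \<open>f(a) \<mapsto> f(a')\<close> is a partial embedding; by Zorn's lemma it extends to the whole
  closure. The extension is onto because it permutes the finitely many roots of each polynomial
  over the base field.
\<close>

theorem galois_conjugate:
  fixes a a' :: "'k::field alg_closure"
  assumes vanish: "\<And>f. poly (to_acp f) a = 0 \<Longrightarrow> poly (to_acp f) a' = 0"
  obtains \<sigma> where "\<sigma> \<in> galois_group" "\<sigma> a = a'"
proof -
  define \<Gamma>0 where "\<Gamma>0 = {(poly (to_acp f) a, poly (to_acp f) a') | f. True}"
  have \<Gamma>0I: "(poly (to_acp f) a, poly (to_acp f) a') \<in> \<Gamma>0" for f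
    unfolding \<Gamma>0_def by blast
  have \<Gamma>0: "partial_embedding \<Gamma>0"
    unfolding partial_embedding_def
  proof (intro conjI allI impI)
    fix c show "(to_ac c, to_ac c) \<in> \<Gamma>0"
      using \<Gamma>0I[of "[:c:]"] by (simp add: map_poly_pCons)
  next
    fix x y x' y' assume "(x, y) \<in> \<Gamma>0" "(x', y') \<in> \<Gamma>0"
    then obtain f g where "x = poly (to_acp f) a" "y = poly (to_acp f) a'"
      "x' = poly (to_acp g) a" "y' = poly (to_acp g) a'"
      by (auto simp: \<Gamma>0_def)
    then show "(x + x', y + y') \<in> \<Gamma>0" "(x * x', y * y') \<in> \<Gamma>0"
      using \<Gamma>0I[of "f + g"] \<Gamma>0I[of "f * g"] by (simp_all add: to_acp_add to_acp_mult)
  next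
    fix y assume "(0, y) \<in> \<Gamma>0"
    then show "y = 0" using vanish by (auto simp: \<Gamma>0_def)
  qed
  define E where "E = {\<Gamma>. partial_embedding \<Gamma> \<and> \<Gamma>0 \<subseteq> \<Gamma>}"
  have "\<exists>M\<in>E. \<forall>Y\<in>E. M \<subseteq> Y \<longrightarrow> Y = M"
  proof (rule subset_Zorn_nonempty)
    show "E \<noteq> {}" using \<Gamma>0 by (auto simp: E_def)
  next
    fix C assume ne: "C \<noteq> {}" and chain: "subset.chain E C"
    then have "subset.chain (Collect partial_embedding) C"
      by (auto simp: subset.chain_def E_def)
    then have "partial_embedding (\<Union>C)" using ne by (rule partial_embedding_Union)
    moreover have "\<Gamma>0 \<subseteq> \<Union>C" using ne chain unfolding subset.chain_def E_def by blast
    ultimately show "\<Union>C \<in> E" by (simp add: E_def)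
  qed
  then obtain M where "M \<in> E" and maxE: "\<And>Y. Y \<in> E \<Longrightarrow> M \<subseteq> Y \<Longrightarrow> Y = M"
    by auto
  then have M: "partial_embedding M" "\<Gamma>0 \<subseteq> M" by (simp_all add: E_def)
  have max: "Y = M" if "partial_embedding Y" "M \<subseteq> Y" for Y
    using that M(2) by (intro maxE) (auto simp: E_def)
  have total: "\<exists>d. (c, d) \<in> M" for c
    using partial_embedding_extend[OF M(1), of c] max by metis
  define \<sigma> where "\<sigma> c = (SOME d. (c, d) \<in> M)" for c
  have graph: "(c, \<sigma> c) \<in> M" for c
    unfolding \<sigma>_def using total by (rule someI_ex)
  have eq: "\<sigma> c = d" if "(c, d) \<in> M" for c d
    using partial_embedding_unique[OF M(1) graph that] .
  have add: "\<sigma> (x + y) = \<sigma> x + \<sigma> y" and mult: "\<sigma> (x * y) = \<sigma> x * \<sigma> y" for x y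
    by (intro eq partial_embeddingD(2,3)[OF M(1)] graph)+
  have fixes_base: "\<sigma> (to_ac c) = to_ac c" for c
    by (intro eq partial_embeddingD(1)[OF M(1)])
  have \<sigma>0: "\<sigma> 0 = 0" using fixes_base[of 0] by simp
  have inj: "inj \<sigma>"
  proof (rule injI)
    fix x y assume "\<sigma> x = \<sigma> y"
    then have "(x - y, 0) \<in> M"
      using partial_embedding_more(4)[OF M(1) graph graph, of x y] by simp
    then show "x = y" using partial_embedding_eq_0_iff[OF M(1)] by fastforce
  qed
  have "surj \<sigma>"
  proof -
    have "\<exists>x. y = \<sigma> x" for y
    proof -
    obtain p where p: "p \<noteq> 0" "poly (to_acp p) y = 0" by (rule alg_closure_algebraic)
    let ?R = "{x. poly (to_acp p) x = 0}"
    have "finite ?R" using p by (intro poly_roots_finite) simp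
    moreover have "\<sigma> ` ?R \<subseteq> ?R"
    proof clarify
      fix x assume "poly (to_acp p) x = 0"
      moreover have "map_poly \<sigma> (to_acp p) = to_acp p"
        by (intro poly_eqI) (simp add: coeff_map_poly \<sigma>0 fixes_base)
      ultimately show "poly (to_acp p) (\<sigma> x) = 0"
        using map_poly_hom_poly[of \<sigma> "to_acp p" x] by (simp add: \<sigma>0 add mult)
    qed
    ultimately have "\<sigma> ` ?R = ?R"
      using inj by (intro endo_inj_surj) (auto intro: inj_on_subset)
    then show ?thesis using p(2) by blast
    qed
    then show ?thesis by (auto simp: surj_def)
  qed
  then have "\<sigma> \<in> galois_group"
    using inj by (auto simp: galois_group_def bij_def add mult fixes_base)
  moreover have "\<sigma> a = a'"
    using \<Gamma>0I[of "[:0, 1:]"] M(2) by (intro eq) (auto simp: map_poly_pCons)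
  ultimately show ?thesis by (rule that)
qed

section \<open>Valuations\<close>

lemma valuationD:
  assumes "valuation v"
  shows "v x \<noteq> Minf" "v x = Pinf \<longleftrightarrow> x = 0" "v (x * y) = v x + v y" "min (v x) (v y) \<le> v (x + y)"
  using assms by (auto simp: valuation_def)

lemma valuation_Fin:
  assumes "valuation v" "x \<noteq> 0"
  obtains g where "v x = Fin g"
  using valuationD(1,2)[OF assms(1), of x] assms(2) by (cases "v x") auto

lemma valuation_0: "valuation v \<Longrightarrow> v 0 = Pinf"
  by (simp add: valuationD)

lemma valuation_1:
  assumes v: "valuation v"
  shows "v 1 = Fin 0"
proof -
  obtain g where g: "v 1 = Fin g" by (rule valuation_Fin[OF v, of 1]) simp_all
  with valuationD(3)[OF v, of 1 1] show ?thesis by simp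
qed

lemma valuation_minus:
  assumes v: "valuation v"
  shows "v (- x) = v x"
proof -
  obtain g where g: "v (-1) = Fin g" by (rule valuation_Fin[OF v, of "-1"]) simp_all
  with valuationD(3)[OF v, of "-1" "-1"] have "g + g = 0" by (simp add: valuation_1[OF v])
  with g have "v (-1) = Fin 0" by (simp add: double_zero)
  with valuationD(3)[OF v, of "-1" x] show ?thesis by (cases "v x") auto
qed

lemma valuation_diff:
  assumes v: "valuation v"
  shows "min (v x) (v y) \<le> v (x - y)"
  using valuationD(4)[OF v, of x "-y"] by (simp add: valuation_minus[OF v])

lemma valuation_diff_commute:
  assumes v: "valuation v"
  shows "v (x - y) = v (y - x)"
  using valuation_minus[OF v, of "x - y"] by simp

text \<open>In the ultrametric inequality the smaller of two different values wins.\<close>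

lemma valuation_eqI:
  assumes v: "valuation v" and less: "v x < v (x - y)"
  shows "v y = v x"
proof (rule antisym)
  have "min (v (x - y)) (v y) \<le> v x"
    using valuationD(4)[OF v, of "x - y" y] by simp
  then show "v y \<le> v x" using less by (auto simp: min_def split: if_splits)
  have "min (v x) (v (x - y)) \<le> v y"
    using valuation_diff[OF v, of x "x - y"] by simp
  then show "v x \<le> v y" using less by (auto simp: min_def split: if_splits)
qed

lemma Fin_nat_scale_Suc: "Fin a + Fin (nat_scale n a) = Fin (nat_scale (Suc n) a)"
  by (simp add: nat_scale_def add.commute)

lemma nat_scale_mono: "a \<le> b \<Longrightarrow> nat_scale n a \<le> nat_scale n b"
  unfolding nat_scale_def by (rule sum_mono)

lemma omega_linear:
  assumes v: "valuation v"
  shows "omega v b \<delta> [:- c, 1:] = min (v (b - c)) (Fin \<delta>)"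
proof -
  have "{..degree [:- c, 1:]} = {0, 1}" by auto
  moreover have "pcompose [:- c, 1:] [:b, 1:] = [:b - c, 1:]"
    by (simp add: pcompose_pCons)
  moreover have "v (b - c) + Fin 0 = v (b - c)"
    by (cases "v (b - c)") auto
  ultimately show ?thesis
    by (simp add: omega_def nat_scale_def valuation_1[OF v])
qed

lemma closed_ball_subset:
  assumes v: "valuation v" and "\<delta> \<le> \<delta>'" and ab: "Fin \<delta> \<le> v (a - b)"
  shows "closed_ball v b \<delta>' \<subseteq> closed_ball v a \<delta>"
proof
  fix c assume "c \<in> closed_ball v b \<delta>'"
  then have "Fin \<delta>' \<le> v (b - c)" by (simp add: closed_ball_def)
  then have "Fin \<delta> \<le> v (b - c)" using assms(2) by (meson less_eq_extended.simps(1) order_trans)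
  with ab have "Fin \<delta> \<le> min (v (a - b)) (v (b - c))" by simp
  also have "\<dots> \<le> v (a - c)" using valuationD(4)[OF v, of "a - b" "b - c"] by simp
  finally show "c \<in> closed_ball v a \<delta>" by (simp add: closed_ball_def)
qed

section \<open>Comparing values on a minimal polynomial\<close>

lemma valuation_prod_le:
  assumes V1: "valuation V1" and V2: "valuation V2"
    and le: "\<And>c. c \<in># M \<Longrightarrow> V1 (f c) \<le> (V2 (f c) :: 'g::linordered_ab_group_add extended)"
  shows "V1 (\<Prod>c\<in>#M. f c) \<le> V2 (\<Prod>c\<in>#M. f c)"
  using le
  by (induction M) (auto simp: valuation_1[OF V1] valuation_1[OF V2] valuationD(3)[OF V1]
      valuationD(3)[OF V2] intro!: add_mono)

lemma valuation_prod_less: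
  assumes V1: "valuation V1" and V2: "valuation V2"
    and le: "\<And>c. c \<in># M \<Longrightarrow> V1 (f c) \<le> (V2 (f c) :: 'g::linordered_ab_group_add extended)"
    and nz: "\<And>c. c \<in># M \<Longrightarrow> f c \<noteq> 0"
    and a: "a \<in># M" and less: "V1 (f a) < V2 (f a)"
  shows "V1 (\<Prod>c\<in>#M. f c) < V2 (\<Prod>c\<in>#M. f c)"
proof -
  obtain N where M: "M = add_mset a N" using a by (metis insert_DiffM)
  have le': "V1 (\<Prod>c\<in>#N. f c) \<le> V2 (\<Prod>c\<in>#N. f c)"
    by (rule valuation_prod_le[OF V1 V2]) (use le in \<open>simp add: M\<close>)
  have "(\<Prod>c\<in>#N. f c) \<noteq> 0" using nz by (auto simp: M)
  then obtain g1 g2 where "V1 (\<Prod>c\<in>#N. f c) = Fin g1" "V2 (\<Prod>c\<in>#N. f c) = Fin g2"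
    by (metis valuation_Fin V1 V2)
  moreover have "f a \<noteq> 0" using nz a by blast
  then obtain h1 h2 where "V1 (f a) = Fin h1" "V2 (f a) = Fin h2"
    by (metis valuation_Fin V1 V2)
  ultimately show ?thesis
    using le' less by (simp add: M valuationD(3)[OF V1] valuationD(3)[OF V2] add_less_le_mono)
qed

text \<open>
  Let \<open>\<phi>\<close> be the minimal polynomial of \<open>a\<close> and \<open>a'\<close> a root of it nearest to \<open>b\<close>, so
  that \<open>\<nu>' (b - c) \<le> \<nu>' (a' - c)\<close> for every root \<open>c\<close> by the ultrametric inequality. If
  the ball around \<open>b\<close> were not contained in the one around \<open>a'\<close>, each linear factor of
  \<open>\<phi>\<close> would have at most the value under \<open>omega \<nu>' b \<delta>'\<close> that it has under
  \<open>omega \<nu>' a' \<delta>\<close>, with strict inequality for \<open>x - a'\<close>. As \<open>a'\<close> is conjugate to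
  \<open>a\<close>, both valuations restrict to the given ones, and \<open>\<phi>\<close> would violate \<open>\<mu> \<le> \<mu>'\<close>.
\<close>

lemma closed_ball_subset_conjugate:
  fixes \<nu>' :: "'k::field alg_closure \<Rightarrow> 'g::linordered_ab_group_add extended"
  assumes \<nu>': "valuation \<nu>'"
    and ext_a: "\<And>\<sigma>. \<sigma> \<in> galois_group \<Longrightarrow> omega \<nu>' (\<sigma> a) \<delta> \<in> extensions \<nu>' \<mu>"
    and ext_b: "omega \<nu>' b \<delta>' \<in> extensions \<nu>' \<mu>'"
    and le: "\<And>f. \<mu> f \<le> \<mu>' f"
  obtains \<sigma> where "\<sigma> \<in> galois_group" "closed_ball \<nu>' b \<delta>' \<subseteq> closed_ball \<nu>' (\<sigma> a) \<delta>"
proof -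
  define Q where "Q f \<longleftrightarrow> f \<noteq> 0 \<and> poly (to_acp f) a = 0" for f
  have "\<exists>f. Q f" unfolding Q_def by (metis alg_closure_algebraic)
  then obtain \<phi> where \<phi>: "Q \<phi>" and least: "\<And>f. Q f \<Longrightarrow> degree \<phi> \<le> degree f"
    using ex_has_least_nat[of Q _ degree] by blast
  have \<phi>0: "\<phi> \<noteq> 0" using \<phi> by (simp add: Q_def)
  have conj: "\<exists>\<sigma>\<in>galois_group. \<sigma> a = c" if c: "poly (to_acp \<phi>) c = 0" for c
  proof -
    have "poly (to_acp f) c = 0" if f: "poly (to_acp f) a = 0" for f
    proof -
      have eq: "to_acp f = to_acp (f div \<phi>) * to_acp \<phi> + to_acp (f mod \<phi>)"
        by (simp flip: to_acp_add to_acp_mult)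
      then have "poly (to_acp (f mod \<phi>)) a = 0"
        using \<phi> f by (simp add: Q_def)
      then have "f mod \<phi> = 0"
        using least[of "f mod \<phi>"] degree_mod_less'[OF \<phi>0, of f] by (fastforce simp: Q_def)
      with eq c show ?thesis by simp
    qed
    then show ?thesis by (metis galois_conjugate)
  qed
  define R where "R = {c. poly (to_acp \<phi>) c = 0}"
  have fin: "finite R" unfolding R_def using \<phi>0 by (intro poly_roots_finite) simp
  have aR: "a \<in> R" using \<phi> by (simp add: R_def Q_def)
  define t where "t = Max ((\<lambda>c. \<nu>' (b - c)) ` R)"
  have "t \<in> (\<lambda>c. \<nu>' (b - c)) ` R" unfolding t_def using fin aR by (intro Max_in) auto
  then obtain a' where a': "a' \<in> R" "t = \<nu>' (b - a')" by auto
  have t: "\<nu>' (b - c) \<le> t" if "c \<in> R" for c unfolding t_def using fin that by simp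
  obtain \<sigma> where \<sigma>: "\<sigma> \<in> galois_group" "\<sigma> a = a'" using conj a'(1) by (auto simp: R_def)
  define V1 V2 where "V1 = omega \<nu>' b \<delta>'" and "V2 = omega \<nu>' a' \<delta>"
  have V2e: "V2 \<in> extensions \<nu>' \<mu>" using ext_a[OF \<sigma>(1)] by (simp add: V2_def \<sigma>(2))
  have V1: "valuation V1" and V2: "valuation V2"
    and const: "V1 [:c:] = \<nu>' c" "V2 [:c:] = \<nu>' c"
    and V1_to_ac: "V1 (to_acp f) = \<mu>' f" and V2_to_ac: "V2 (to_acp f) = \<mu> f" for c f
    using ext_b V2e by (auto simp: V1_def extensions_def poly_valuation_def)
  have lin: "V1 [:- c, 1:] = min (\<nu>' (b - c)) (Fin \<delta>')" "V2 [:- c, 1:] = min (\<nu>' (a' - c)) (Fin \<delta>)" for c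
    by (simp_all add: V1_def V2_def omega_linear[OF \<nu>'])
  have "Fin \<delta> \<le> min t (Fin \<delta>')"
  proof (rule ccontr)
    assume "\<not> Fin \<delta> \<le> min t (Fin \<delta>')"
    then have small: "min t (Fin \<delta>') < Fin \<delta>" by (rule not_le[THEN iffD1])
    have le12: "V1 [:- c, 1:] \<le> V2 [:- c, 1:]" if c: "c \<in> R" for c
    proof -
      have "min (\<nu>' (b - c)) t \<le> \<nu>' (a' - c)"
        using valuation_diff[OF \<nu>', of "b - c" "b - a'"] a'(2) by simp
      then have "\<nu>' (b - c) \<le> \<nu>' (a' - c)" using t[OF c] by (simp add: min_absorb1)
      moreover have "min (\<nu>' (b - c)) (Fin \<delta>') \<le> Fin \<delta>"
        using min.mono[OF t[OF c] order_refl] small by (meson le_less_trans less_imp_le)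
      ultimately show ?thesis unfolding lin by (auto intro: min.coboundedI1)
    qed
    obtain M where M: "to_acp \<phi> = smult (lead_coeff (to_acp \<phi>)) (\<Prod>c\<in>#M. [:-c, 1:])"
      using alg_closed_imp_factorization[of "to_acp \<phi>"] \<phi>0 by auto
    define l where "l = lead_coeff (to_acp \<phi>)"
    have l: "l \<noteq> 0" using \<phi>0 by (simp add: l_def)
    have root: "c \<in> R \<longleftrightarrow> c \<in># M" for c
      unfolding R_def by (subst M) (use l in \<open>auto simp: l_def poly_prod_mset prod_mset_zero_iff\<close>)
    have "V1 (\<Prod>c\<in>#M. [:-c, 1:]) < V2 (\<Prod>c\<in>#M. [:-c, 1:])"
    proof (rule valuation_prod_less[OF V1 V2])
      show "a' \<in># M" using a'(1) root by simp
      show "V1 [:- a', 1:] < V2 [:- a', 1:]"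
        using small by (simp add: lin a'(2) valuation_0[OF \<nu>'])
    qed (use le12 root in auto)
    moreover have smult: "V1 (smult l p) = \<nu>' l + V1 p" "V2 (smult l p) = \<nu>' l + V2 p" for p
      using valuationD(3)[OF V1, of "[:l:]" p] valuationD(3)[OF V2, of "[:l:]" p]
      by (simp_all add: const)
    moreover obtain g where "\<nu>' l = Fin g" by (rule valuation_Fin[OF \<nu>' l])
    ultimately have "V1 (to_acp \<phi>) < V2 (to_acp \<phi>)"
      unfolding M[folded l_def] smult
      by (cases "V1 (\<Prod>c\<in>#M. [:-c, 1:])"; cases "V2 (\<Prod>c\<in>#M. [:-c, 1:])") auto
    then show False using le[of \<phi>] by (simp add: V1_to_ac V2_to_ac)
  qed
  then have "closed_ball \<nu>' b \<delta>' \<subseteq> closed_ball \<nu>' a' \<delta>"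
    using a'(2) valuation_diff_commute[OF \<nu>'] by (intro closed_ball_subset[OF \<nu>']) auto
  with \<sigma> show ?thesis using that by blast
qed

section \<open>Balls as orbits of the Galois group\<close>

text \<open>The composite of \<open>\<nu>'\<close> with \<open>\<sigma>\<close> is again an extension of \<open>\<nu>\<close>, hence equals \<open>\<nu>'\<close>.\<close>

lemma galois_invariant:
  assumes hens: "henselian \<nu>" and ext: "extends_to_closure \<nu> \<nu>'" and \<sigma>: "\<sigma> \<in> galois_group"
  shows "\<nu>' (\<sigma> x) = \<nu>' x"
proof -
  note hom = galois_hom[OF \<sigma>]
  have v: "valuation \<nu>'" using ext by (simp add: extends_to_closure_def)
  have "extends_to_closure \<nu> (\<nu>' \<circ> \<sigma>)"
    using ext valuationD[OF v] by (simp add: extends_to_closure_def valuation_def hom)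
  with hens ext have "\<nu>' \<circ> \<sigma> = \<nu>'" unfolding henselian_def by blast
  then show ?thesis by (metis comp_apply)
qed

lemma closed_ball_galois_image:
  assumes hens: "henselian \<nu>" and ext: "extends_to_closure \<nu> \<nu>'" and \<sigma>: "\<sigma> \<in> galois_group"
  shows "\<sigma> ` closed_ball \<nu>' b \<delta> = closed_ball \<nu>' (\<sigma> b) \<delta>"
proof -
  note hom = galois_hom[OF \<sigma>] and inv = galois_invariant[OF hens ext \<sigma>]
  have iff: "\<sigma> c \<in> closed_ball \<nu>' (\<sigma> b) \<delta> \<longleftrightarrow> c \<in> closed_ball \<nu>' b \<delta>" for c
    using inv[of "b - c"] by (simp add: closed_ball_def hom)
  show ?thesis
  proof (intro equalityI subsetI)
    fix y assume y: "y \<in> closed_ball \<nu>' (\<sigma> b) \<delta>"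
    obtain c where "y = \<sigma> c" using hom(7) by (metis bij_pointE)
    with y iff show "y \<in> \<sigma> ` closed_ball \<nu>' b \<delta>" by simp
  qed (use iff in auto)
qed

lemma omega_galois:
  assumes hens: "henselian \<nu>" and ext: "extends_to_closure \<nu> \<nu>'" and \<sigma>: "\<sigma> \<in> galois_group"
  shows "omega \<nu>' (\<sigma> a) \<delta> (map_poly \<sigma> f) = omega \<nu>' a \<delta> f"
proof -
  note hom = galois_hom[OF \<sigma>] and inv = galois_invariant[OF hens ext \<sigma>]
  have "degree (map_poly \<sigma> f) = degree f"
    by (cases "f = 0") (auto simp: hom(8) intro: map_poly_degree_eq)
  moreover have "pcompose (map_poly \<sigma> f) [:\<sigma> a, 1:] = map_poly \<sigma> (pcompose f [:a, 1:])"
    by (simp add: map_poly_hom_pcompose[OF hom(1,3,4)] map_poly_pCons hom)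
  ultimately show ?thesis
    by (simp add: omega_def coeff_map_poly hom inv)
qed

lemma extensions_galois:
  assumes hens: "henselian \<nu>" and ext: "extends_to_closure \<nu> \<nu>'" and \<sigma>: "\<sigma> \<in> galois_group"
    and mem: "omega \<nu>' a \<delta> \<in> extensions \<nu>' \<mu>"
  shows "omega \<nu>' (\<sigma> a) \<delta> \<in> extensions \<nu>' \<mu>"
proof -
  define \<tau> where "\<tau> = inv_into UNIV \<sigma>"
  have \<tau>: "\<tau> \<in> galois_group" unfolding \<tau>_def by (rule galois_group_inv[OF \<sigma>])
  have "\<tau> (\<sigma> a) = a" using galois_hom(7)[OF \<sigma>] by (simp add: \<tau>_def bij_is_inj)
  then have eq: "omega \<nu>' (\<sigma> a) \<delta> f = omega \<nu>' a \<delta> (map_poly \<tau> f)" for f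
    using omega_galois[OF hens ext \<tau>, of "\<sigma> a" \<delta> f] by simp
  note hom = galois_hom[OF \<tau>]
  have v: "valuation (omega \<nu>' a \<delta>)"
    and c: "omega \<nu>' a \<delta> [:c:] = \<nu>' c" and r: "omega \<nu>' a \<delta> (to_acp f) = \<mu> f" for c f
    using mem by (auto simp: extensions_def poly_valuation_def)
  have m0: "map_poly \<tau> f = 0 \<longleftrightarrow> f = 0" for f
    by (rule map_poly_eq_0_iff) (auto simp: hom(8))
  have "valuation (omega \<nu>' (\<sigma> a) \<delta>)"
    unfolding valuation_def eq
    using valuationD[OF v] map_poly_hom_add[OF hom(1,3)] map_poly_hom_mult[OF hom(1,3,4)]
    by (simp add: m0)
  moreover have "omega \<nu>' (\<sigma> a) \<delta> [:c:] = \<nu>' c" for c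
    unfolding eq by (simp add: map_poly_pCons hom c galois_invariant[OF hens ext \<tau>])
  moreover have "omega \<nu>' (\<sigma> a) \<delta> (to_acp f) = \<mu> f" for f
    unfolding eq by (simp add: to_acp_hom_invariant[OF \<tau>] r)
  ultimately show ?thesis by (simp add: extensions_def poly_valuation_def)
qed

lemma omega_eq_imp_closed_ball_eq:
  assumes v: "valuation v" and eq: "omega v a \<delta> = omega v b \<delta>"
  shows "closed_ball v a \<delta> = closed_ball v b \<delta>"
proof -
  have "min (v (b - a)) (Fin \<delta>) = Fin \<delta>"
    using omega_linear[OF v, of a \<delta> a] omega_linear[OF v, of b \<delta> a]
    by (simp add: eq valuation_0[OF v])
  then have "Fin \<delta> \<le> v (b - a)" by (metis min.cobounded1)
  then show ?thesis
    using closed_ball_subset[OF v] valuation_diff_commute[OF v, of a b] by (metis order_refl subset_antisym)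
qed

text \<open>
  A ball family is listed by finitely many automorphisms, but every conjugate valuation is an
  extension too and so occurs in the list: the family is a full orbit.
\<close>

lemma is_ball_family_orbit:
  assumes hens: "henselian \<nu>" and ext: "extends_to_closure \<nu> \<nu>'"
    and fam: "is_ball_family \<nu> \<nu>' \<mu> \<B>"
  obtains a \<delta> where "finite \<B>" "\<B> = (\<lambda>\<sigma>. closed_ball \<nu>' (\<sigma> a) \<delta>) ` galois_group"
    "\<And>\<sigma>. \<sigma> \<in> galois_group \<Longrightarrow> omega \<nu>' (\<sigma> a) \<delta> \<in> extensions \<nu>' \<mu>"
proof -
  obtain a \<delta> S where S: "S \<subseteq> galois_group" "finite S" "S \<noteq> {}"
    and E: "extensions \<nu>' \<mu> = (\<lambda>\<sigma>. omega \<nu>' (\<sigma> a) \<delta>) ` S"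
    and \<B>: "\<B> = (\<lambda>\<sigma>. closed_ball \<nu>' (\<sigma> a) \<delta>) ` S"
    using fam unfolding is_ball_family_def by blast
  obtain \<sigma>0 where \<sigma>0: "\<sigma>0 \<in> S" using S(3) by blast
  have v: "valuation \<nu>'" using ext by (simp add: extends_to_closure_def)
  have mem: "omega \<nu>' (\<sigma> a) \<delta> \<in> extensions \<nu>' \<mu>" if \<sigma>: "\<sigma> \<in> galois_group" for \<sigma>
  proof -
    define \<tau> where "\<tau> = \<sigma> \<circ> inv_into UNIV \<sigma>0"
    have "\<tau> \<in> galois_group"
      unfolding \<tau>_def using \<sigma> \<sigma>0 S(1) by (blast intro: galois_group_comp galois_group_inv)
    moreover have "\<tau> (\<sigma>0 a) = \<sigma> a"
      using galois_hom(7)[of \<sigma>0] \<sigma>0 S(1) by (auto simp: \<tau>_def bij_is_inj)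
    ultimately show ?thesis
      using extensions_galois[OF hens ext, of \<tau> "\<sigma>0 a" \<delta> \<mu>] E \<sigma>0 by auto
  qed
  have "closed_ball \<nu>' (\<sigma> a) \<delta> \<in> \<B>" if "\<sigma> \<in> galois_group" for \<sigma>
    using mem[OF that] omega_eq_imp_closed_ball_eq[OF v] unfolding E \<B> by blast
  then have "\<B> = (\<lambda>\<sigma>. closed_ball \<nu>' (\<sigma> a) \<delta>) ` galois_group" using S(1) \<B> by blast
  moreover have "finite \<B>" using S(2) \<B> by simp
  ultimately show ?thesis using mem by (intro that)
qed

text \<open>
  The Galois group permutes both families transitively and respects inclusion, so every ball of
  the first family contains the same number of balls of the second.
\<close>

lemma ball_families_decreasing:
  fixes \<nu> :: "'k::field \<Rightarrow> 'g::linordered_ab_group_add extended"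
  assumes hens: "henselian \<nu>" and ext: "extends_to_closure \<nu> \<nu>'"
    and fam: "is_ball_family \<nu> \<nu>' \<mu> \<B>" and fam': "is_ball_family \<nu> \<nu>' \<mu>' \<B>'"
    and le: "\<And>f. \<mu> f \<le> \<mu>' f"
  shows "(\<exists>s>0. \<forall>b\<in>\<B>. card {c\<in>\<B>'. c \<subseteq> b} = s) \<and> (\<forall>c\<in>\<B>'. \<exists>b\<in>\<B>. c \<subseteq> b)"
proof -
  have v: "valuation \<nu>'" using ext by (simp add: extends_to_closure_def)
  obtain a \<delta> where a: "\<B> = (\<lambda>\<sigma>. closed_ball \<nu>' (\<sigma> a) \<delta>) ` galois_group"
    "\<And>\<sigma>. \<sigma> \<in> galois_group \<Longrightarrow> omega \<nu>' (\<sigma> a) \<delta> \<in> extensions \<nu>' \<mu>"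
    by (rule is_ball_family_orbit[OF hens ext fam]) blast
  obtain a' \<delta>' where a': "finite \<B>'" "\<B>' = (\<lambda>\<sigma>. closed_ball \<nu>' (\<sigma> a') \<delta>') ` galois_group"
    "\<And>\<sigma>. \<sigma> \<in> galois_group \<Longrightarrow> omega \<nu>' (\<sigma> a') \<delta>' \<in> extensions \<nu>' \<mu>'"
    by (rule is_ball_family_orbit[OF hens ext fam']) blast
  have inside: "\<exists>b\<in>\<B>. c \<subseteq> b" if "c \<in> \<B>'" for c
  proof -
    obtain \<tau> where \<tau>: "\<tau> \<in> galois_group" "c = closed_ball \<nu>' (\<tau> a') \<delta>'" using \<open>c \<in> \<B>'\<close> a'(2) by blast
    obtain \<sigma> where "\<sigma> \<in> galois_group" "c \<subseteq> closed_ball \<nu>' (\<sigma> a) \<delta>"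
      using closed_ball_subset_conjugate[OF v a(2) a'(3)[OF \<tau>(1)] le] unfolding \<tau>(2) .
    then show ?thesis using a(1) by blast
  qed
  have image: "\<sigma> ` c \<in> \<B>'" if \<sigma>: "\<sigma> \<in> galois_group" and c: "c \<in> \<B>'" for \<sigma> c
  proof -
    obtain \<tau> where \<tau>: "\<tau> \<in> galois_group" "c = closed_ball \<nu>' (\<tau> a') \<delta>'" using c a'(2) by blast
    then have "\<sigma> ` c = closed_ball \<nu>' ((\<sigma> \<circ> \<tau>) a') \<delta>'"
      by (simp add: closed_ball_galois_image[OF hens ext \<sigma>])
    then show ?thesis using galois_group_comp[OF \<sigma> \<tau>(1)] a'(2) by blast
  qed
  have le_card: "card {c\<in>\<B>'. c \<subseteq> b} \<le> card {c\<in>\<B>'. c \<subseteq> b'}" if b: "b \<in> \<B>" and b': "b' \<in> \<B>" for b b'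
  proof -
    obtain \<sigma> \<sigma>' where \<sigma>: "\<sigma> \<in> galois_group" "b = closed_ball \<nu>' (\<sigma> a) \<delta>"
      and \<sigma>': "\<sigma>' \<in> galois_group" "b' = closed_ball \<nu>' (\<sigma>' a) \<delta>"
      using b b' a(1) by blast
    define \<rho> where "\<rho> = \<sigma>' \<circ> inv_into UNIV \<sigma>"
    have \<rho>: "\<rho> \<in> galois_group"
      unfolding \<rho>_def by (intro galois_group_comp galois_group_inv \<sigma> \<sigma>')
    have "\<rho> (\<sigma> a) = \<sigma>' a" using galois_hom(7)[OF \<sigma>(1)] by (simp add: \<rho>_def bij_is_inj)
    then have \<rho>b: "\<rho> ` b = b'" by (simp add: \<sigma>(2) \<sigma>'(2) closed_ball_galois_image[OF hens ext \<rho>])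
    have inj: "inj_on ((`) \<rho>) {c\<in>\<B>'. c \<subseteq> b}"
      using galois_hom(7)[OF \<rho>] by (auto intro!: inj_onI simp: inj_image_eq_iff bij_is_inj)
    have "(`) \<rho> ` {c\<in>\<B>'. c \<subseteq> b} \<subseteq> {c\<in>\<B>'. c \<subseteq> b'}"
      using image[OF \<rho>] \<rho>b by blast
    then show ?thesis using a'(1) by (intro card_inj_on_le[OF inj]) auto
  qed
  have "\<exists>b0\<in>\<B>. \<exists>c\<in>\<B>'. c \<subseteq> b0"
    using inside a'(2) galois_group_id by blast
  then obtain b0 where b0: "b0 \<in> \<B>" "{c\<in>\<B>'. c \<subseteq> b0} \<noteq> {}" by blast
  then have "card {c\<in>\<B>'. c \<subseteq> b0} > 0" using a'(1) by (simp add: card_gt_0_iff)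
  moreover have "\<forall>b\<in>\<B>. card {c\<in>\<B>'. c \<subseteq> b} = card {c\<in>\<B>'. c \<subseteq> b0}"
    using le_card b0(1) by (meson le_antisym)
  ultimately show ?thesis using inside by blast
qed

section \<open>Augmentation increases valuations\<close>

text \<open>
  If no remainder of the successive divisions by \<open>\<phi>\<close> has smaller value than its dividend, then
  the multiples of \<open>\<phi>\<close> that are split off do not either, and every term of the expansion in powers of \<open>\<phi>\<close>
  has at least the value of \<open>f\<close>. Key polynomials and limit key polynomials both reach this situation.
\<close>

lemma valuation_le_expansion_term:
  assumes v: "valuation w" and \<phi>: "w \<phi> = Fin g"
    and rem: "\<And>i. i \<le> j \<Longrightarrow> w (f div \<phi> ^ i) \<le> w (f div \<phi> ^ i mod \<phi>)"
  shows "w f \<le> w (expansion_coeff \<phi> f j) + Fin (nat_scale j g)"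
proof -
  have quot: "w f \<le> w (f div \<phi> ^ i) + Fin (nat_scale i g)" if "i \<le> j" for i
    using that
  proof (induction i)
    case 0
    then show ?case by (cases "w f") (auto simp: nat_scale_def)
  next
    case (Suc i)
    define h where "h = f div \<phi> ^ i"
    have h: "h div \<phi> = f div \<phi> ^ Suc i"
      by (simp only: h_def power_Suc2 poly_div_mult_right)
    have "w h \<le> min (w h) (w (h mod \<phi>))" using rem[of i] Suc.prems by (simp add: h_def)
    also have "\<dots> \<le> w (h - h mod \<phi>)" by (rule valuation_diff[OF v])
    also have "h - h mod \<phi> = h div \<phi> * \<phi>" by (simp add: minus_mod_eq_div_mult)
    also have "w (h div \<phi> * \<phi>) = w (f div \<phi> ^ Suc i) + Fin g"
      by (simp only: valuationD(3)[OF v] \<phi> h)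
    finally have "w h + Fin (nat_scale i g) \<le> w (f div \<phi> ^ Suc i) + Fin g + Fin (nat_scale i g)"
      by (rule add_right_mono)
    also have "\<dots> = w (f div \<phi> ^ Suc i) + Fin (nat_scale (Suc i) g)"
      by (simp only: add.assoc Fin_nat_scale_Suc)
    finally show ?case using Suc by (simp only: h_def) (meson Suc_leD order_trans)
  qed
  have "w f \<le> w (f div \<phi> ^ j) + Fin (nat_scale j g)" by (rule quot) simp
  also have "\<dots> \<le> w (expansion_coeff \<phi> f j) + Fin (nat_scale j g)"
    unfolding expansion_coeff_def by (intro add_right_mono rem) simp
  finally show ?thesis .
qed

text \<open>
  A remainder of smaller value than the dividend is equivalent to minus the multiple of \<open>\<phi>\<close>
  that was subtracted.
\<close>

lemma val_dvd_remainder: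
  assumes v: "valuation w" and less: "w (h mod \<phi>) < w h"
  shows "val_dvd w \<phi> (h mod \<phi>)"
proof -
  have "h mod \<phi> - \<phi> * (- (h div \<phi>)) = h"
    by simp
  then have "val_equiv w (h mod \<phi>) (\<phi> * (- (h div \<phi>)))"
    using less valuation_eqI[OF v, of "h mod \<phi>" "\<phi> * (- (h div \<phi>))"]
    by (simp only: val_equiv_def)
  then show ?thesis unfolding val_dvd_def by blast
qed

lemma degree_monic_diff_less:
  fixes p q :: "'r::comm_ring_1 poly"
  assumes "lead_coeff p = 1" "lead_coeff q = 1" "degree p = degree q" "p - q \<noteq> 0"
  shows "degree (p - q) < degree q"
proof -
  have "coeff (p - q) (degree q) = 0" using assms(1-3) by simp
  moreover have "degree (p - q) \<le> degree q" using assms(3) by (intro degree_diff_le) auto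
  ultimately show ?thesis using assms(4) by (metis le_neq_implies_less leading_coeff_0_iff)
qed

lemma key_polynomial_remainder:
  assumes v: "valuation w" and key: "key_polynomial w \<phi>"
  shows "w h \<le> w (h mod \<phi>)"
proof (rule ccontr)
  assume "\<not> w h \<le> w (h mod \<phi>)"
  then have less: "w (h mod \<phi>) < w h" by simp
  then have nz: "h mod \<phi> \<noteq> 0" using valuation_0[OF v] by auto
  have "degree \<phi> \<le> degree (h mod \<phi>)"
    using key val_dvd_remainder[OF v less] nz by (simp add: key_polynomial_def val_minimal_def)
  moreover have "\<phi> \<noteq> 0" using key by (auto simp: key_polynomial_def)
  ultimately show False using degree_mod_less'[of \<phi> h] nz by simp
qed

lemma augmentedD:
  assumes "augmented \<nu> w \<phi> \<gamma> w'"
  shows "valuation w" "key_polynomial w \<phi>" "w \<phi> < Fin \<gamma>" "w' = augment w \<phi> \<gamma>" "\<phi> \<noteq> 0"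
    "lead_coeff \<phi> = 1"
  using assms by (auto simp: augmented_def poly_valuation_def key_polynomial_def)

lemma augmented_mono:
  assumes aug: "augmented \<nu> w \<phi> \<gamma> w'"
  shows "w f \<le> w' f"
proof -
  note D = augmentedD[OF aug]
  obtain g where g: "w \<phi> = Fin g" by (rule valuation_Fin[OF D(1,5)])
  have "w f \<le> w (expansion_coeff \<phi> f j) + Fin (nat_scale j \<gamma>)" for j
  proof -
    have "w f \<le> w (expansion_coeff \<phi> f j) + Fin (nat_scale j g)"
      by (intro valuation_le_expansion_term D g key_polynomial_remainder)
    also have "\<dots> \<le> w (expansion_coeff \<phi> f j) + Fin (nat_scale j \<gamma>)"
      using D(3) g by (intro add_left_mono) (simp add: nat_scale_mono)
    finally show ?thesis .
  qed
  then show ?thesis by (simp add: D(4) augment_def)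
qed

lemma augmented_le_remainder:
  assumes aug: "augmented \<nu> w \<phi> \<gamma> w'"
  shows "w' f \<le> w (f mod \<phi>)"
proof -
  have "w' f \<le> w (expansion_coeff \<phi> f 0) + Fin (nat_scale 0 \<gamma>)"
    unfolding augmentedD(4)[OF aug] augment_def by (intro Min_le) auto
  also have "\<dots> = w (f mod \<phi>)"
    by (cases "w (f mod \<phi>)") (auto simp: expansion_coeff_def nat_scale_def)
  finally show ?thesis .
qed

lemma augmented_key_value:
  assumes aug: "augmented \<nu> w \<phi> \<gamma> w'"
  shows "Fin \<gamma> \<le> w' \<phi>"
proof -
  note D = augmentedD[OF aug]
  have "Fin \<gamma> \<le> w (expansion_coeff \<phi> \<phi> j) + Fin (nat_scale j \<gamma>)" for j
  proof (cases "j = 1 \<and> degree \<phi> > 0")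
    case True
    then have "expansion_coeff \<phi> \<phi> j = 1"
      using D(5) by (simp add: expansion_coeff_def mod_poly_less)
    then show ?thesis using True by (simp add: valuation_1[OF D(1)] nat_scale_def)
  next
    case False
    have "expansion_coeff \<phi> \<phi> j = 0"
    proof (cases "degree \<phi> = 0")
      case True
      then have "\<phi> dvd 1" using D(5) by (simp add: is_unit_iff_degree)
      then show ?thesis unfolding expansion_coeff_def by (metis mod_0_imp_dvd dvd_imp_mod_0 dvd_trans one_dvd)
    next
      case deg: False
      then consider "j = 0" | "j \<ge> 2" using False by linarith
      then show ?thesis
      proof cases
        case 2
        have "degree \<phi> < 2 * degree \<phi>" using deg by simp
        also have "\<dots> \<le> j * degree \<phi>" using 2 by simp
        also have "\<dots> = degree (\<phi> ^ j)" using D(5) by (simp add: degree_power_eq)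
        finally show ?thesis by (simp add: expansion_coeff_def div_poly_less)
      qed (simp add: expansion_coeff_def)
    qed
    then show ?thesis by (simp add: valuation_0[OF D(1)])
  qed
  then show ?thesis by (simp add: D(4) augment_def)
qed

text \<open>
  Augmentation by \<open>\<phi>\<close> raises the value of exactly those polynomials that \<open>\<phi>\<close> divides up to
  equivalence. This is one direction, for all pairs of valuations, since limits need it too;
  \<open>augmented_less_imp_val_dvd\<close> is the other.
\<close>

lemma val_dvd_imp_less:
  assumes v: "valuation w" "valuation w'" and le: "\<And>f. w f \<le> w' f" and \<phi>: "w \<phi> < w' \<phi>"
    and dvd: "val_dvd w \<phi> f"
  shows "w f < w' f"
proof -
  obtain h where less: "w f < w (f - \<phi> * h)" and eq: "w f = w (\<phi> * h)"
    using dvd by (auto simp: val_dvd_def val_equiv_def)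
  have "\<phi> * h \<noteq> 0" using less eq valuation_0[OF v(1)] by auto
  then have h: "h \<noteq> 0" and \<phi>0: "\<phi> \<noteq> 0" by auto
  have "w (\<phi> * h) < w' (\<phi> * h)"
  proof -
    obtain a b c d where "w \<phi> = Fin a" "w' \<phi> = Fin b" "w h = Fin c" "w' h = Fin d"
      using h \<phi>0 v by (metis valuation_Fin)
    then show ?thesis using \<phi> le[of h]
      by (simp add: valuationD(3)[OF v(1)] valuationD(3)[OF v(2)] add_less_le_mono)
  qed
  moreover have "w f < w' (f - \<phi> * h)" using less le order_less_le_trans by blast
  ultimately have "w f < min (w' (f - \<phi> * h)) (w' (\<phi> * h))" using eq by simp
  also have "\<dots> \<le> w' f" using valuationD(4)[OF v(2), of "f - \<phi> * h" "\<phi> * h"] by simp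
  finally show ?thesis .
qed

lemma augmented_less_imp_val_dvd:
  assumes aug: "augmented \<nu> w \<phi> \<gamma> w'" and less: "w f < w' f"
  shows "val_dvd w \<phi> f"
proof -
  have "w f < w (f mod \<phi>)" using less augmented_le_remainder[OF aug, of f] by (rule less_le_trans)
  moreover have r: "f mod \<phi> = f - \<phi> * (f div \<phi>)" by (simp add: minus_mult_div_eq_mod)
  ultimately have lt: "w f < w (f - \<phi> * (f div \<phi>))" by (simp only:)
  have "val_equiv w f (\<phi> * (f div \<phi>))"
    unfolding val_equiv_def using lt valuation_eqI[OF augmentedD(1)[OF aug] lt] by (simp only: simp_thms)
  then show ?thesis unfolding val_dvd_def by blast
qed

section \<open>Continuous families and limit augmentation\<close>

lemma continuous_familyD:
  assumes "continuous_family \<nu> \<mu>0 d A \<phi>s \<gamma>s \<mu>s"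
  shows "A \<noteq> {}" "\<alpha> \<in> A \<Longrightarrow> \<exists>\<beta>\<in>A. \<alpha> < \<beta>" "\<alpha> \<in> A \<Longrightarrow> degree (\<phi>s \<alpha>) = d"
    "\<alpha> \<in> A \<Longrightarrow> augmented \<nu> \<mu>0 (\<phi>s \<alpha>) (\<gamma>s \<alpha>) (\<mu>s \<alpha>)"
    "\<alpha> \<in> A \<Longrightarrow> \<beta> \<in> A \<Longrightarrow> \<alpha> < \<beta> \<Longrightarrow> augmented \<nu> (\<mu>s \<alpha>) (\<phi>s \<beta>) (\<gamma>s \<beta>) (\<mu>s \<beta>)"
  using assms by (auto simp: continuous_family_def)

lemma continuous_family_valuation:
  assumes "continuous_family \<nu> \<mu>0 d A \<phi>s \<gamma>s \<mu>s" "\<alpha> \<in> A"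
  shows "valuation (\<mu>s \<alpha>)"
  using continuous_familyD(2,5)[OF assms(1)] assms(2) augmentedD(1) by metis

lemma continuous_family_mono:
  assumes "continuous_family \<nu> \<mu>0 d A \<phi>s \<gamma>s \<mu>s" "\<alpha> \<in> A" "\<beta> \<in> A" "\<alpha> \<le> \<beta>"
  shows "\<mu>s \<alpha> f \<le> \<mu>s \<beta> f"
proof (cases "\<alpha> = \<beta>")
  case False
  with assms(4) have "\<alpha> < \<beta>" by simp
  then show ?thesis using augmented_mono continuous_familyD(5)[OF assms(1-3)] by metis
qed simp

text \<open>
  Otherwise \<open>\<psi>\<close> would be equivalent to \<open>\<psi> - \<phi>\<close>, a polynomial of smaller degree.
\<close>

lemma key_polynomial_value_ge:
  assumes v: "valuation w" and key: "key_polynomial w \<psi>"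
    and \<phi>: "lead_coeff \<phi> = 1" "degree \<phi> = degree \<psi>" and \<gamma>: "Fin \<gamma> \<le> w \<phi>"
  shows "Fin \<gamma> \<le> w (\<psi> - \<phi>)"
proof (rule ccontr)
  let ?g = "\<psi> - \<phi>"
  assume "\<not> Fin \<gamma> \<le> w ?g"
  then have less: "w ?g < w \<phi>" using \<gamma> by simp
  then have nz: "?g \<noteq> 0" using valuation_0[OF v] by auto
  have "?g - \<psi> * 1 = - \<phi>" by simp
  then have "w ?g < w (?g - \<psi> * 1)" using less valuation_minus[OF v, of \<phi>] by presburger
  then have "val_equiv w ?g (\<psi> * 1)" using valuation_eqI[OF v, of ?g "\<psi> * 1"] by (simp add: val_equiv_def)
  then have "degree \<psi> \<le> degree ?g"
    using key nz unfolding key_polynomial_def val_minimal_def val_dvd_def by blast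
  moreover have "degree ?g < degree \<phi>"
    using key \<phi> nz by (intro degree_monic_diff_less) (auto simp: key_polynomial_def)
  ultimately show False using \<phi>(2) by simp
qed

text \<open>
  The number \<open>\<gamma>s \<beta>\<close> separates the two values. Write \<open>\<phi>s \<beta>' = \<phi>s \<beta> + g\<close> with \<open>g\<close> of degree
  less than \<open>d\<close>. Both summands have value at least \<open>\<gamma>s \<beta>\<close> under \<open>\<mu>s \<beta>\<close>. Under
  \<open>\<mu>s \<alpha>\<close> the first has smaller value than that, and \<open>g\<close> cannot compensate it: the value
  of \<open>g\<close> would then increase from \<open>\<mu>s \<alpha>\<close> to \<open>\<mu>s \<beta>\<close>, so that \<open>\<phi>s \<beta>\<close> would divide
  \<open>g\<close> up to equivalence.
\<close>

lemma continuous_family_key_value_less: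
  assumes cf: "continuous_family \<nu> \<mu>0 d A \<phi>s \<gamma>s \<mu>s"
    and mem: "\<alpha> \<in> A" "\<beta> \<in> A" "\<beta>' \<in> A" and ord: "\<alpha> < \<beta>" "\<beta> < \<beta>'"
  shows "\<mu>s \<alpha> (\<phi>s \<beta>') < \<mu>s \<beta> (\<phi>s \<beta>')"
proof -
  note D = continuous_familyD[OF cf]
  have aug: "augmented \<nu> (\<mu>s \<alpha>) (\<phi>s \<beta>) (\<gamma>s \<beta>) (\<mu>s \<beta>)" by (intro D mem ord)
  have aug': "augmented \<nu> (\<mu>s \<beta>) (\<phi>s \<beta>') (\<gamma>s \<beta>') (\<mu>s \<beta>')" by (intro D mem ord)
  note a = augmentedD[OF aug] and b = augmentedD[OF aug']
  let ?g = "\<phi>s \<beta>' - \<phi>s \<beta>"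
  have deg: "degree (\<phi>s \<beta>) = d" "degree (\<phi>s \<beta>') = d" by (intro D mem)+
  have g\<beta>: "Fin (\<gamma>s \<beta>) \<le> \<mu>s \<beta> ?g"
    using a(6) deg augmented_key_value[OF aug] by (intro key_polynomial_value_ge[OF b(1,2)]) auto
  have \<beta>: "Fin (\<gamma>s \<beta>) \<le> \<mu>s \<beta> (\<phi>s \<beta>')"
  proof -
    have "Fin (\<gamma>s \<beta>) \<le> min (\<mu>s \<beta> ?g) (\<mu>s \<beta> (\<phi>s \<beta>))"
      using g\<beta> augmented_key_value[OF aug] by simp
    also have "\<dots> \<le> \<mu>s \<beta> (\<phi>s \<beta>')" using valuationD(4)[OF b(1), of ?g "\<phi>s \<beta>"] by simp
    finally show ?thesis .
  qed
  have "\<mu>s \<alpha> (\<phi>s \<beta>') < Fin (\<gamma>s \<beta>)"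
  proof (rule ccontr)
    assume "\<not> \<mu>s \<alpha> (\<phi>s \<beta>') < Fin (\<gamma>s \<beta>)"
    then have "\<mu>s \<alpha> (- \<phi>s \<beta>) < \<mu>s \<alpha> (- \<phi>s \<beta> - ?g)"
      using a(3) by (simp add: valuation_minus[OF a(1)])
    then have "\<mu>s \<alpha> ?g = \<mu>s \<alpha> (- \<phi>s \<beta>)" by (rule valuation_eqI[OF a(1)])
    then have eq: "\<mu>s \<alpha> ?g = \<mu>s \<alpha> (\<phi>s \<beta>)" by (simp add: valuation_minus[OF a(1)])
    then have less: "\<mu>s \<alpha> ?g < \<mu>s \<beta> ?g" using a(3) g\<beta> by simp
    then have nz: "?g \<noteq> 0" using valuation_0[OF a(1)] by auto
    have "degree (\<phi>s \<beta>) \<le> degree ?g"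
      using a(2) nz augmented_less_imp_val_dvd[OF aug less]
      unfolding key_polynomial_def val_minimal_def by blast
    moreover have "degree ?g < degree (\<phi>s \<beta>)"
      using a(6) b(6) deg nz by (intro degree_monic_diff_less) auto
    ultimately show False by simp
  qed
  with \<beta> show ?thesis by simp
qed

text \<open>
  If the value of \<open>f\<close> increased from \<open>\<mu>s \<alpha>\<close> to \<open>\<mu>s \<beta>'\<close>, then \<open>\<phi>s \<beta>'\<close> would
  divide \<open>f\<close> up to equivalence for \<open>\<mu>s \<alpha>\<close>; its own value increases already at
  \<open>\<mu>s \<beta>\<close>, hence so would that of \<open>f\<close>.
\<close>

lemma continuous_family_stable:
  assumes cf: "continuous_family \<nu> \<mu>0 d A \<phi>s \<gamma>s \<mu>s"
    and mem: "\<alpha> \<in> A" "\<beta> \<in> A" "\<beta>' \<in> A" and ord: "\<alpha> < \<beta>" "\<alpha> \<le> \<beta>'"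
    and eq: "\<mu>s \<alpha> f = \<mu>s \<beta> f"
  shows "\<mu>s \<beta>' f = \<mu>s \<alpha> f"
proof (rule antisym)
  show "\<mu>s \<alpha> f \<le> \<mu>s \<beta>' f" by (intro continuous_family_mono[OF cf] mem ord)
  show "\<mu>s \<beta>' f \<le> \<mu>s \<alpha> f"
  proof (cases "\<beta>' \<le> \<beta>")
    case True
    then show ?thesis using continuous_family_mono[OF cf mem(3,2)] eq by simp
  next
    case False
    then have less: "\<beta> < \<beta>'" by simp
    have v: "valuation (\<mu>s \<alpha>)" "valuation (\<mu>s \<beta>)"
      by (intro continuous_family_valuation[OF cf] mem)+
    have mono: "\<mu>s \<alpha> h \<le> \<mu>s \<beta> h" for h
      using ord(1) by (intro continuous_family_mono[OF cf mem(1,2)]) simp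
    have aug: "augmented \<nu> (\<mu>s \<alpha>) (\<phi>s \<beta>') (\<gamma>s \<beta>') (\<mu>s \<beta>')"
      using less ord by (intro continuous_familyD(5)[OF cf] mem) auto
    show ?thesis
    proof (rule ccontr)
      assume "\<not> \<mu>s \<beta>' f \<le> \<mu>s \<alpha> f"
      then have "val_dvd (\<mu>s \<alpha>) (\<phi>s \<beta>') f"
        by (intro augmented_less_imp_val_dvd[OF aug]) simp
      then have "\<mu>s \<alpha> f < \<mu>s \<beta> f"
        using val_dvd_imp_less[OF v mono continuous_family_key_value_less[OF cf mem ord(1) less]]
        by simp
      with eq show False by simp
    qed
  qed
qed

text \<open>The stationary value is also the largest one, so the supremum is attained.\<close>

lemma not_limit_poly_stable:
  assumes cf: "continuous_family \<nu> \<mu>0 d A \<phi>s \<gamma>s \<mu>s" and f: "f \<notin> limit_polys A \<mu>s"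
  shows "\<exists>\<alpha>. \<alpha> \<in> A \<and> (\<forall>\<beta>\<in>A. \<alpha> \<le> \<beta> \<longrightarrow> \<mu>s \<beta> f = \<mu>s \<alpha> f) \<and>
    (LEAST u. \<forall>\<beta>\<in>A. \<mu>s \<beta> f \<le> u) = \<mu>s \<alpha> f"
proof -
  obtain \<alpha> \<beta> where \<alpha>: "\<alpha> \<in> A" "\<beta> \<in> A" "\<alpha> < \<beta>" and "\<not> \<mu>s \<alpha> f < \<mu>s \<beta> f"
    using f by (auto simp: limit_polys_def)
  then have eq: "\<mu>s \<alpha> f = \<mu>s \<beta> f"
    using continuous_family_mono[OF cf \<alpha>(1,2), of f] by simp
  have stable: "\<mu>s \<beta>' f = \<mu>s \<alpha> f" if "\<beta>' \<in> A" "\<alpha> \<le> \<beta>'" for \<beta>'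
    by (rule continuous_family_stable[OF cf \<alpha>(1,2) that(1) \<alpha>(3) that(2) eq])
  have "\<mu>s \<beta>' f \<le> \<mu>s \<alpha> f" if "\<beta>' \<in> A" for \<beta>'
    using stable[OF that] continuous_family_mono[OF cf that \<alpha>(1), of f] by (cases "\<alpha> \<le> \<beta>'") auto
  then have "(LEAST u. \<forall>\<beta>\<in>A. \<mu>s \<beta> f \<le> u) = \<mu>s \<alpha> f"
    using \<alpha>(1) by (intro Least_equality) auto
  with stable \<alpha>(1) show ?thesis by blast
qed

text \<open>
  The nonzero coefficients of the expansion of \<open>f\<close> have too small degree to lie in \<open>limit_polys\<close>, so
  their values are constant from some index \<open>\<beta>\<close> on, the same for all. At \<open>\<mu>s \<beta>\<close> the
  limit key polynomial behaves like a key polynomial for the divisions that produce the expansion: a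
  remainder of smaller value than its dividend would be divisible by \<open>\<phi>\<close> up to equivalence, and
  its value would increase with that of \<open>\<phi>\<close>.
\<close>

lemma limit_augmented_mono:
  assumes cf: "continuous_family \<nu> \<mu>0 d A \<phi>s \<gamma>s \<mu>s"
    and lim: "limit_augmented A \<mu>s \<phi> \<gamma> \<mu>'" and \<alpha>: "\<alpha> \<in> A"
  shows "\<mu>s \<alpha> f \<le> \<mu>' f"
proof -
  have \<phi>: "lead_coeff \<phi> = 1" "\<phi> \<in> limit_polys A \<mu>s"
    and least: "\<And>g. g \<in> limit_polys A \<mu>s \<Longrightarrow> degree \<phi> \<le> degree g"
    and \<gamma>: "\<And>\<alpha>. \<alpha> \<in> A \<Longrightarrow> \<mu>s \<alpha> \<phi> < Fin \<gamma>" and \<mu>': "\<mu>' = limit_augment A \<mu>s \<phi> \<gamma>"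
    using lim by (auto simp: limit_augmented_def limit_key_polynomial_def)
  have \<phi>0: "\<phi> \<noteq> 0" using \<phi>(1) by auto
  have zero: "0 \<notin> limit_polys A \<mu>s"
  proof
    assume "0 \<in> limit_polys A \<mu>s"
    moreover obtain \<beta> where \<beta>: "\<beta> \<in> A" "\<alpha> < \<beta>" using continuous_familyD(2)[OF cf \<alpha>] by blast
    ultimately have "\<mu>s \<alpha> 0 < \<mu>s \<beta> 0" using \<alpha> by (auto simp: limit_polys_def)
    then show False using valuation_0[OF continuous_family_valuation[OF cf \<alpha>]] by simp
  qed
  have rem: "h mod \<phi> \<notin> limit_polys A \<mu>s" for h
  proof (cases "h mod \<phi> = 0")
    case False
    then show ?thesis using degree_mod_less'[OF \<phi>0 False] least[of "h mod \<phi>"] by (meson not_le)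
  qed (simp add: zero)
  define n where "n = degree f"
  let ?e = "expansion_coeff \<phi> f"
  have "\<forall>j. \<exists>\<alpha>. \<alpha> \<in> A \<and> (\<forall>\<beta>\<in>A. \<alpha> \<le> \<beta> \<longrightarrow> \<mu>s \<beta> (?e j) = \<mu>s \<alpha> (?e j)) \<and>
      (LEAST u. \<forall>\<beta>\<in>A. \<mu>s \<beta> (?e j) \<le> u) = \<mu>s \<alpha> (?e j)"
    using not_limit_poly_stable[OF cf rem] unfolding expansion_coeff_def by blast
  from choice[OF this] obtain a where a: "\<And>j. a j \<in> A \<and>
      (\<forall>\<beta>\<in>A. a j \<le> \<beta> \<longrightarrow> \<mu>s \<beta> (?e j) = \<mu>s (a j) (?e j)) \<and>
      (LEAST u. \<forall>\<beta>\<in>A. \<mu>s \<beta> (?e j) \<le> u) = \<mu>s (a j) (?e j)"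
    by (elim exE) (rule that, erule spec)
  have aA: "a j \<in> A" for j using a by blast
  have sup: "(LEAST u. \<forall>\<beta>\<in>A. \<mu>s \<beta> (?e j) \<le> u) = \<mu>s (a j) (?e j)" for j using a by blast
  have stable: "\<mu>s \<beta> (?e j) = \<mu>s (a j) (?e j)" if "\<beta> \<in> A" "a j \<le> \<beta>" for j \<beta>
    using a[of j] that by blast
  define \<beta> where "\<beta> = Max (insert \<alpha> (a ` {..n}))"
  have \<beta>A: "\<beta> \<in> A"
  proof -
    have "\<beta> \<in> insert \<alpha> (a ` {..n})" unfolding \<beta>_def by (intro Max_in) auto
    then show ?thesis using \<alpha> aA by auto
  qed
  have \<beta>: "\<alpha> \<le> \<beta>" "\<And>j. j \<le> n \<Longrightarrow> a j \<le> \<beta>" unfolding \<beta>_def by (rule Max_ge; simp)+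
  have v: "valuation (\<mu>s \<beta>)" by (rule continuous_family_valuation[OF cf \<beta>A])
  obtain \<beta>' where \<beta>': "\<beta>' \<in> A" "\<beta> < \<beta>'" using continuous_familyD(2)[OF cf \<beta>A] by blast
  have v': "valuation (\<mu>s \<beta>')" by (rule continuous_family_valuation[OF cf \<beta>'(1)])
  have mono: "\<mu>s \<beta> h \<le> \<mu>s \<beta>' h" for h
    using \<beta>' by (intro continuous_family_mono[OF cf \<beta>A]) auto
  have rem_ge: "\<mu>s \<beta> (f div \<phi> ^ j) \<le> \<mu>s \<beta> (f div \<phi> ^ j mod \<phi>)" if j: "j \<le> n" for j
  proof (rule ccontr)
    assume "\<not> ?thesis"
    then have dvd: "val_dvd (\<mu>s \<beta>) \<phi> (f div \<phi> ^ j mod \<phi>)"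
      by (intro val_dvd_remainder[OF v]) simp
    have "\<mu>s \<beta> \<phi> < \<mu>s \<beta>' \<phi>" using \<phi>(2) \<beta>A \<beta>' by (auto simp: limit_polys_def)
    then have "\<mu>s \<beta> (f div \<phi> ^ j mod \<phi>) < \<mu>s \<beta>' (f div \<phi> ^ j mod \<phi>)"
      by (rule val_dvd_imp_less[OF v v' mono _ dvd])
    moreover have "\<mu>s \<beta> (expansion_coeff \<phi> f j) = \<mu>s \<beta>' (expansion_coeff \<phi> f j)"
      using stable[OF \<beta>A \<beta>(2)[OF j]] stable[OF \<beta>'(1), of j] \<beta>(2)[OF j] \<beta>'(2) by auto
    ultimately show False by (simp add: expansion_coeff_def)
  qed
  obtain g where g: "\<mu>s \<beta> \<phi> = Fin g" by (rule valuation_Fin[OF v \<phi>0])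
  have "\<mu>s \<alpha> f \<le> \<mu>s (a j) (expansion_coeff \<phi> f j) + Fin (nat_scale j \<gamma>)" if j: "j \<le> n" for j
  proof -
    have "\<mu>s \<alpha> f \<le> \<mu>s \<beta> f" by (rule continuous_family_mono[OF cf \<alpha> \<beta>A \<beta>(1)])
    also have "\<dots> \<le> \<mu>s \<beta> (expansion_coeff \<phi> f j) + Fin (nat_scale j g)"
      using j by (intro valuation_le_expansion_term[OF v g] rem_ge) simp
    also have "\<dots> \<le> \<mu>s \<beta> (expansion_coeff \<phi> f j) + Fin (nat_scale j \<gamma>)"
      using \<gamma>[OF \<beta>A] g by (intro add_left_mono) (simp add: nat_scale_mono)
    also have "\<mu>s \<beta> (expansion_coeff \<phi> f j) = \<mu>s (a j) (expansion_coeff \<phi> f j)"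
      using stable[OF \<beta>A \<beta>(2)[OF j]] .
    finally show ?thesis .
  qed
  then show ?thesis by (simp add: \<mu>' limit_augment_def sup n_def)
qed

section \<open>Admissible families\<close>

lemma initial_segmentD:
  assumes "initial_segment L"
  shows "1 \<in> L" "l \<in> L \<Longrightarrow> 1 \<le> l" "l \<in> L \<Longrightarrow> 1 \<le> k \<Longrightarrow> k \<le> l \<Longrightarrow> k \<in> L"
  using assms by (auto simp: initial_segment_def)

lemma simple_family_disc_mono:
  assumes sf: "simple_family \<nu> L \<phi>d \<gamma>d \<mu>d A \<phi>c \<gamma>c \<mu>c"
    and l: "l \<in> L" "l' \<in> L" "l \<le> l'"
  shows "\<mu>d l f \<le> \<mu>d l' f"
proof -
  have L: "initial_segment L" using sf by (simp add: simple_family_def)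
  show ?thesis
    using l(3,2)
  proof (induction l' rule: dec_induct)
    case (step n)
    have "1 \<le> l" using initial_segmentD(2)[OF L l(1)] .
    then have "n \<in> L" using initial_segmentD(3)[OF L step.prems] step.hyps by simp
    moreover have "2 \<le> Suc n" using \<open>1 \<le> l\<close> step.hyps by simp
    then have "augmented \<nu> (\<mu>d (Suc n - 1)) (\<phi>d (Suc n)) (\<gamma>d (Suc n)) (\<mu>d (Suc n))"
      using sf step.prems unfolding simple_family_def by blast
    then have "\<mu>d n f \<le> \<mu>d (Suc n) f" using augmented_mono by fastforce
    ultimately show ?case using step.IH by (meson order_trans)
  qed simp
qed

lemma simple_family_disc_cont_mono:
  assumes sf: "simple_family \<nu> L \<phi>d \<gamma>d \<mu>d A \<phi>c \<gamma>c \<mu>c"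
    and l: "l \<in> L" and \<alpha>: "\<alpha> \<in> A"
  shows "\<mu>d l f \<le> \<mu>c \<alpha> f"
proof -
  have fin: "finite L" and cf: "continuous_family \<nu> (\<mu>d (Max L)) (degree (\<phi>d (Max L))) A \<phi>c \<gamma>c \<mu>c"
    using sf \<alpha> by (auto simp: simple_family_def)
  have "\<mu>d l f \<le> \<mu>d (Max L) f"
    using l fin by (intro simple_family_disc_mono[OF sf]) (auto intro!: Max_in)
  also have "\<dots> \<le> \<mu>c \<alpha> f" using augmented_mono[OF continuous_familyD(4)[OF cf \<alpha>]] .
  finally show ?thesis .
qed

lemma simple_family_cont_mono:
  assumes sf: "simple_family \<nu> L \<phi>d \<gamma>d \<mu>d A \<phi>c \<gamma>c \<mu>c"
    and \<alpha>: "\<alpha> \<in> A" "\<beta> \<in> A" "\<alpha> \<le> \<beta>"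
  shows "\<mu>c \<alpha> f \<le> \<mu>c \<beta> f"
proof -
  have "continuous_family \<nu> (\<mu>d (Max L)) (degree (\<phi>d (Max L))) A \<phi>c \<gamma>c \<mu>c"
    using sf \<alpha> by (auto simp: simple_family_def)
  then show ?thesis using \<alpha> by (rule continuous_family_mono)
qed

fun block :: "'a fam_index \<Rightarrow> nat" where
  "block (Disc j l) = j"
| "block (Cont j \<alpha>) = j"

lemma admissible_family_mono:
  fixes \<mu>s :: "'a::linorder fam_index \<Rightarrow> 'k::field poly \<Rightarrow> 'g::linordered_ab_group_add extended"
  assumes adm: "admissible_family \<nu> J L A \<mu>s"
    and i: "i \<in> fam_indices J L A" and i': "i' \<in> fam_indices J L A" and less: "fam_less i i'"
  shows "\<mu>s i f \<le> \<mu>s i' f"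
proof -
  obtain \<phi> \<gamma> where J: "initial_segment J"
    and sf: "\<And>j. j \<in> J \<Longrightarrow> simple_family \<nu>
           (L j) (\<lambda>l. \<phi> (Disc j l)) (\<lambda>l. \<gamma> (Disc j l)) (\<lambda>l. \<mu>s (Disc j l))
           (A j) (\<lambda>\<alpha>. \<phi> (Cont j \<alpha>)) (\<lambda>\<alpha>. \<gamma> (Cont j \<alpha>)) (\<lambda>\<alpha>. \<mu>s (Cont j \<alpha>))"
    and step: "\<And>j. j \<in> J \<Longrightarrow> Suc j \<in> J \<Longrightarrow> A j \<noteq> {} \<and>
           limit_augmented (A j) (\<lambda>\<alpha>. \<mu>s (Cont j \<alpha>))
             (\<phi> (Disc (Suc j) 1)) (\<gamma> (Disc (Suc j) 1)) (\<mu>s (Disc (Suc j) 1))"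
    using adm unfolding admissible_family_def by blast
  have one: "1 \<in> L j" if "j \<in> J" for j
    using sf[OF that] initial_segmentD(1) by (auto simp: simple_family_def)
  have first: "\<mu>s (Disc (block k) 1) f \<le> \<mu>s k f" if k: "k \<in> fam_indices J L A" for k
  proof (cases k)
    case (Disc j l)
    then have "j \<in> J" "l \<in> L j" using k by (auto simp: fam_indices_def)
    moreover from this have "1 \<le> l"
      using sf initial_segmentD(2) unfolding simple_family_def by blast
    ultimately show ?thesis using simple_family_disc_mono[OF sf one] Disc by simp
  next
    case (Cont j \<alpha>)
    then have "j \<in> J" "\<alpha> \<in> A j" using k by (auto simp: fam_indices_def)
    then show ?thesis using simple_family_disc_cont_mono[OF sf one] Cont by simp
  qed
  have cont_next: "\<mu>s (Cont j \<alpha>) f \<le> \<mu>s (Disc (Suc j) 1) f"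
    if j: "j \<in> J" "Suc j \<in> J" and \<alpha>: "\<alpha> \<in> A j" for j \<alpha>
  proof -
    have "continuous_family \<nu> (\<mu>s (Disc j (Max (L j)))) (degree (\<phi> (Disc j (Max (L j)))))
        (A j) (\<lambda>\<alpha>. \<phi> (Cont j \<alpha>)) (\<lambda>\<alpha>. \<gamma> (Cont j \<alpha>)) (\<lambda>\<alpha>. \<mu>s (Cont j \<alpha>))"
      using sf[OF j(1)] \<alpha> by (auto simp: simple_family_def)
    then show ?thesis
      using conjunct2[OF step[OF j]] \<alpha> by (rule limit_augmented_mono)
  qed
  have next_block: "\<mu>s k f \<le> \<mu>s (Disc (Suc (block k)) 1) f"
    if k: "k \<in> fam_indices J L A" and S: "Suc (block k) \<in> J" for k
  proof (cases k)
    case (Cont j \<alpha>)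
    then show ?thesis using cont_next k S by (auto simp: fam_indices_def)
  next
    case (Disc j l)
    then have j: "j \<in> J" "l \<in> L j" "Suc j \<in> J" using k S by (auto simp: fam_indices_def)
    then obtain \<alpha> where \<alpha>: "\<alpha> \<in> A j" using step by blast
    have "\<mu>s (Disc j l) f \<le> \<mu>s (Cont j \<alpha>) f"
      by (rule simple_family_disc_cont_mono[OF sf[OF j(1)] j(2) \<alpha>])
    also have "\<dots> \<le> \<mu>s (Disc (Suc j) 1) f" by (rule cont_next[OF j(1,3) \<alpha>])
    finally show ?thesis using Disc by simp
  qed
  have blocks: "block i \<in> J" "block i' \<in> J" using i i' by (auto simp: fam_indices_def)
  consider "block i < block i'" | "block i = block i'"
    using less by (cases i; cases i') (auto simp: le_less)
  then show ?thesis
  proof cases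
    case 1
    have "\<mu>s i f \<le> \<mu>s (Disc j 1) f" if "Suc (block i) \<le> j" "j \<in> J" for j
      using that
    proof (induction j rule: dec_induct)
      case base
      then show ?case by (rule next_block[OF i])
    next
      case (step n)
      have n: "n \<in> J" using initial_segmentD(3)[OF J step.prems, of n] step.hyps by simp
      then have "Disc n 1 \<in> fam_indices J L A" using one by (auto simp: fam_indices_def)
      then have "\<mu>s (Disc n 1) f \<le> \<mu>s (Disc (Suc n) 1) f" using next_block step.prems by fastforce
      then show ?case using step.IH[OF n] by (rule order_trans[rotated])
    qed
    then have "\<mu>s i f \<le> \<mu>s (Disc (block i') 1) f" using 1 blocks by simp
    also have "\<dots> \<le> \<mu>s i' f" by (rule first[OF i'])
    finally show ?thesis .
  next
    case 2
    show ?thesis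
      using 2 less i i' simple_family_disc_mono[OF sf] simple_family_disc_cont_mono[OF sf]
        simple_family_cont_mono[OF sf]
      by (cases i; cases i') (auto simp: fam_indices_def)
  qed
qed

section \<open>Decreasing families of balls\<close>

theorem proposition3p18:
  fixes \<nu> :: "'k::field \<Rightarrow> 'g::linordered_ab_group_add extended"
    and \<nu>' :: "'k alg_closure \<Rightarrow> 'g extended"
    and \<mu> :: "'k poly \<Rightarrow> 'g extended"
    and J :: "nat set" and L :: "nat \<Rightarrow> nat set" and A :: "nat \<Rightarrow> 'a::linorder set"
    and \<mu>s :: "'a fam_index \<Rightarrow> 'k poly \<Rightarrow> 'g extended"
    and \<B> :: "'a fam_index \<Rightarrow> 'k alg_closure set set"
  assumes "henselian \<nu>"
    and "extends_to_closure \<nu> \<nu>'"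
    and "poly_valuation \<nu> \<mu>"
    and "admissible_family \<nu> J L A \<mu>s"
    and "admitted (fam_indices J L A) \<mu>s"
    and "associated_family (fam_indices J L A) \<mu>s \<mu>"
    and "\<And>i. i \<in> fam_indices J L A \<Longrightarrow> is_ball_family \<nu> \<nu>' (\<mu>s i) (\<B> i)"
  shows "\<forall>i\<in>fam_indices J L A. \<forall>j\<in>fam_indices J L A. fam_less i j \<longrightarrow>
    (\<exists>s>0. \<forall>b\<in>\<B> i. card {c\<in>\<B> j. c \<subseteq> b} = s) \<and>
    (\<forall>c\<in>\<B> j. \<exists>b\<in>\<B> i. c \<subseteq> b)"
proof (intro ballI impI)
  fix i j
  assume i: "i \<in> fam_indices J L A" and j: "j \<in> fam_indices J L A" and "fam_less i j"
  then have "\<mu>s i f \<le> \<mu>s j f" for f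
    by (intro admissible_family_mono[OF assms(4)])
  then show "(\<exists>s>0. \<forall>b\<in>\<B> i. card {c\<in>\<B> j. c \<subseteq> b} = s) \<and>
      (\<forall>c\<in>\<B> j. \<exists>b\<in>\<B> i. c \<subseteq> b)"
    by (rule ball_families_decreasing[OF assms(1,2) assms(7)[OF i] assms(7)[OF j]])
qed

end
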